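(* Let $n\in\mathbb{N}_+$, $r_1,\ldots,r_n\ge 2$ integers, $s,t\in[n]$ with $s\ge 2$, let $\mathcal{S}\subseteq\mathcal{N}$ be a connected $(s,t)$-switchable set, and let $G_{\mathcal{S}}=\{f_{K,a,b} : K\subseteq[t],\ a,b\in\mathcal{S}\}$. Let $d\in\mathbb{N}_+$ and let $p=\prod_{i=1}^d x_{a_i}-\prod_{i=1}^d x_{b_i}\in R$ be a binomial with $a_1,\ldots,a_d,b_1,\ldots,b_d\in\mathcal{S}$, where $a_{j,i}$ (resp. $b_{j,i}$) denotes the $i$-th component of $a_j$ (resp. $b_j$). Then $p$ reduces to $0$ with respect to $G_{\mathcal{S}}$ if and only if the following properties hold: (1) $\sum_{i=1}^d \|a_i\|_{\langle s\rangle}=\sum_{i=1}^d\|b_i\|_{\langle s\rangle}$; (2a) if $s\le t$: for each $i=s+1,\ldots,t$ the multiset $\{a_{1,i},\ldots,a_{d,i}\}$ equals the multiset $\{b_{1,i},\ldots,b_{d,i}\}$, and the multiset $\{(a_{1,t+1},\ldots,a_{1,n}),\ldots,(a_{d,t+1},\ldots,a_{d,n})\}$ equals the multiset $\{(b_{1,t+1},\ldots,b_{1,n}),\ldots,(b_{d,t+1},\ldots,b_{d,n})\}$; (2b) if $s\ge t$: the multiset $\{(a_{1,s+1},\ldots,a_{1,n}),\ldots,(a_{d,s+1},\ldots,a_{d,n})\}$ equals the multiset $\{(b_{1,s+1},\ldots,b_{1,n}),\ldots,(b_{d,s+1},\ldots,b_{d,n})\}$.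
   Context: Notation: $[r]=\{1,\ldots,r\}$, $\mathcal{N}=[r_1]\times\cdots\times[r_n]$ (indices), $\Bbbk$ is an arbitrary field. For $a\in\mathbb{Z}^n$, $\|a\|_{\langle s\rangle}=\sum_{i=1}^s|a_i|$. Two indices $a,b\in\mathcal{N}$ are $s$-equivalent if $\sum_{i=1}^s a_i=\sum_{i=1}^s b_i$ and $a_i=b_i$ for $i=s+1,\ldots,n$. The normal form $\overline{a}$ of $a$ is the lexicographically largest index of $\mathcal{N}$ that is $s$-equivalent to $a$. $R=\Bbbk[x_a: a\in\mathcal{N}]$ is the polynomial ring where the variables are identified by $x_a=x_b$ if and only if $a,b$ are $s$-equivalent (so variables correspond bijectively to $s$-equivalence classes). Variables are ordered by $x_a<x_b$ iff $\overline a<\overline b$ lexicographically, and $R$ carries the corresponding lexicographic monomial order. For $L\subseteq[n]$ and $a,b\in\mathcal{N}$, $\mathrm{sw}(L,a,b)\in\mathcal{N}$ is the index whose $i$-th component is $b_i$ if $i\in L$ and $a_i$ if $i\notin L$; write $\mathrm{sw}(i,a,b)$ for $\mathrm{sw}(\{i\},a,b)$. Set $f_{L,a,b}=x_ax_b-x_{\mathrm{sw}(L,a,b)}x_{\mathrm{sw}(L,b,a)}$. The distance is $\mathrm{d}(a,b)=\#\{i\in[n]: a_i\ne b_i\}$. A subset $\mathcal{S}\subseteq\mathcal{N}$ is $(s,t)$-switchable if (i) for all $a,b\in\mathcal{S}$ with $\mathrm{d}(a,b)=2$ and all $i\in[t]$, $\mathrm{sw}(i,a,b)\in\mathcal{S}$;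 and (ii) $\mathcal{S}$ is closed under $s$-equivalence. Indices $a,b\in\mathcal{S}$ are connected in $\mathcal{S}$ if there are $c_0=a,c_1,\ldots,c_k=b$ in $\mathcal{S}$ with $\mathrm{d}(c_{j-1},c_j)=1$ for all $j\in[k]$; $\mathcal{S}$ is connected if any two of its elements are connected in $\mathcal{S}$. "Multiset" means a finite unordered list with multiplicities. "Reduces to $0$ with respect to $G_{\mathcal{S}}$" is meant in the usual sense of Gröbner basis theory (repeated reduction by leading terms of elements of $G_{\mathcal{S}}$) for the lexicographic monomial order on $R$ induced by the variable order $x_a<x_b$ iff $\overline a<\overline b$ lexicographically. *)

theory Defs
  imports
    "HOL-Library.FuncSet"
    "HOL-Library.Multiset"
    "HOL-Library.Fun_Lexorder"
    "HOL-Library.Poly_Mapping"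
begin

section \<open>Indices\<close>

text \<open>An index \<open>a = (a\<^sub>1, \<dots>, a\<^sub>n)\<close> is a function on \<open>{1..n}\<close>, \<open>undefined\<close> elsewhere, so that equality
  of indices is equality of functions and \<^const>\<open>less_fun\<close> (smallest differing position decides) is
  the usual lexicographic order.\<close>

type_synonym index = "nat \<Rightarrow> nat"

definition indices :: "nat \<Rightarrow> (nat \<Rightarrow> nat) \<Rightarrow> index set" where
  "indices n r = (\<Pi>\<^sub>E i\<in>{1..n}. {1..r i})"

text \<open>Components of indices are positive, so no absolute value is needed.\<close>

definition norm_upto :: "nat \<Rightarrow> index \<Rightarrow> nat" where
  "norm_upto s a = (\<Sum>i=1..s. a i)"

definition s_equiv :: "nat \<Rightarrow> (nat \<Rightarrow> nat) \<Rightarrow> nat \<Rightarrow> (index \<times> index) set" where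
  "s_equiv n r s = {(a, b). a \<in> indices n r \<and> b \<in> indices n r \<and>
     (\<Sum>i=1..s. a i) = (\<Sum>i=1..s. b i) \<and> (\<forall>i\<in>{s+1..n}. a i = b i)}"

definition normal_form :: "nat \<Rightarrow> (nat \<Rightarrow> nat) \<Rightarrow> nat \<Rightarrow> index \<Rightarrow> index" where
  "normal_form n r s a =
     (THE b. (a, b) \<in> s_equiv n r s \<and> (\<forall>c. (a, c) \<in> s_equiv n r s \<longrightarrow> c = b \<or> less_fun c b))"

definition sw :: "nat set \<Rightarrow> index \<Rightarrow> index \<Rightarrow> index" where
  "sw L a b = override_on a b L"

definition distance :: "nat \<Rightarrow> index \<Rightarrow> index \<Rightarrow> nat" where
  "distance n a b = card {i\<in>{1..n}. a i \<noteq> b i}"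

definition switchable :: "nat \<Rightarrow> (nat \<Rightarrow> nat) \<Rightarrow> nat \<Rightarrow> nat \<Rightarrow> index set \<Rightarrow> bool" where
  "switchable n r s t S \<longleftrightarrow>
     S \<subseteq> indices n r \<and>
     (\<forall>a\<in>S. \<forall>b\<in>S. distance n a b = 2 \<longrightarrow> (\<forall>i\<in>{1..t}. sw {i} a b \<in> S)) \<and>
     (\<forall>a\<in>S. \<forall>b. (a, b) \<in> s_equiv n r s \<longrightarrow> b \<in> S)"

definition connected_in :: "nat \<Rightarrow> index set \<Rightarrow> index \<Rightarrow> index \<Rightarrow> bool" where
  "connected_in n S a b \<longleftrightarrow>
     (\<exists>(k::nat) c. c 0 = a \<and> c k = b \<and> (\<forall>j\<le>k. c j \<in> S) \<and>
        (\<forall>j\<in>{1..k}. distance n (c (j - 1)) (c j) = 1))"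

definition connected_indices :: "nat \<Rightarrow> index set \<Rightarrow> bool" where
  "connected_indices n S \<longleftrightarrow> (\<forall>a\<in>S. \<forall>b\<in>S. connected_in n S a b)"


section \<open>The polynomial ring and its monomial order\<close>

text \<open>The variable \<open>x\<^sub>a\<close> is the \<open>s\<close>-equivalence class of \<open>a\<close>. The type \<open>'k poly\<close> also contains
  polynomials in sets of indices that are not such classes; the ring \<open>R\<close> consists of the polynomials
  in the variables \<open>x\<^sub>a\<close> with \<open>a\<close> in \<^term>\<open>indices n r\<close>. Everything below is only applied to elements
  of \<open>R\<close>, and reduction steps do not leave \<open>R\<close>.\<close>

type_synonym var = "index set"
type_synonym monom = "var \<Rightarrow>\<^sub>0 nat"
type_synonym 'k poly = "monom \<Rightarrow>\<^sub>0 'k"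

definition var_class :: "nat \<Rightarrow> (nat \<Rightarrow> nat) \<Rightarrow> nat \<Rightarrow> index \<Rightarrow> var" where
  "var_class n r s a = s_equiv n r s `` {a}"

definition X :: "nat \<Rightarrow> (nat \<Rightarrow> nat) \<Rightarrow> nat \<Rightarrow> index \<Rightarrow> 'k::field poly" where
  "X n r s a = Poly_Mapping.single (Poly_Mapping.single (var_class n r s a) 1) 1"

definition var_less :: "nat \<Rightarrow> (nat \<Rightarrow> nat) \<Rightarrow> nat \<Rightarrow> var \<Rightarrow> var \<Rightarrow> bool" where
  "var_less n r s v w \<longleftrightarrow>
     (\<exists>a\<in>indices n r. \<exists>b\<in>indices n r. v = var_class n r s a \<and> w = var_class n r s b \<and>
        less_fun (normal_form n r s a) (normal_form n r s b))"

text \<open>Lexicographic monomial order: the largest variable with different exponents decides. (The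
  order instance of \<^type>\<open>poly_mapping\<close> in the library lets the smallest one decide.)\<close>

definition monom_less :: "nat \<Rightarrow> (nat \<Rightarrow> nat) \<Rightarrow> nat \<Rightarrow> monom \<Rightarrow> monom \<Rightarrow> bool" where
  "monom_less n r s m m' \<longleftrightarrow>
     (\<exists>v. Poly_Mapping.lookup m v < Poly_Mapping.lookup m' v \<and>
        (\<forall>w. var_less n r s v w \<longrightarrow> Poly_Mapping.lookup m w = Poly_Mapping.lookup m' w))"

definition is_leading_monom ::
    "nat \<Rightarrow> (nat \<Rightarrow> nat) \<Rightarrow> nat \<Rightarrow> 'k::field poly \<Rightarrow> monom \<Rightarrow> bool" where
  "is_leading_monom n r s g m \<longleftrightarrow>
     m \<in> Poly_Mapping.keys g \<and> (\<forall>m'\<in>Poly_Mapping.keys g. m' = m \<or> monom_less n r s m' m)"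


section \<open>Reduction\<close>

text \<open>One step cancels some term of \<open>p\<close> (not necessarily the leading one) that is divisible by the
  leading term of some \<open>g \<in> G\<close>. The zero polynomial has no leading monomial, so it is never used.\<close>

definition red_step ::
    "nat \<Rightarrow> (nat \<Rightarrow> nat) \<Rightarrow> nat \<Rightarrow> 'k::field poly set \<Rightarrow> 'k poly \<Rightarrow> 'k poly \<Rightarrow> bool" where
  "red_step n r s G p q \<longleftrightarrow>
     (\<exists>g\<in>G. \<exists>m u. is_leading_monom n r s g m \<and> u + m \<in> Poly_Mapping.keys p \<and>
        q = p - Poly_Mapping.single u (Poly_Mapping.lookup p (u + m) / Poly_Mapping.lookup g m) * g)"

definition reduces_to_zero ::
    "nat \<Rightarrow> (nat \<Rightarrow> nat) \<Rightarrow> nat \<Rightarrow> 'k::field poly set \<Rightarrow> 'k poly \<Rightarrow> bool" where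
  "reduces_to_zero n r s G p \<longleftrightarrow> (red_step n r s G)\<^sup>*\<^sup>* p 0"

definition f_poly ::
    "nat \<Rightarrow> (nat \<Rightarrow> nat) \<Rightarrow> nat \<Rightarrow> nat set \<Rightarrow> index \<Rightarrow> index \<Rightarrow> 'k::field poly" where
  "f_poly n r s L a b =
     X n r s a * X n r s b - X n r s (sw L a b) * X n r s (sw L b a)"

definition G_set :: "nat \<Rightarrow> (nat \<Rightarrow> nat) \<Rightarrow> nat \<Rightarrow> nat \<Rightarrow> index set \<Rightarrow> 'k::field poly set" where
  "G_set n r s t S = {f_poly n r s K a b | K a b. K \<subseteq> {1..t} \<and> a \<in> S \<and> b \<in> S}"


section \<open>Basic facts\<close>

lemma equiv_s_equiv: "equiv (indices n r) (s_equiv n r s)"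
  by (rule equivI) (auto simp: s_equiv_def refl_on_def sym_def trans_def)

lemma var_class_eq_iff:
  assumes "a \<in> indices n r" "b \<in> indices n r"
  shows "var_class n r s a = var_class n r s b \<longleftrightarrow> (a, b) \<in> s_equiv n r s"
  unfolding var_class_def using eq_equiv_class_iff[OF equiv_s_equiv assms] .

lemma finite_indices: "finite (indices n r)"
  by (auto simp: indices_def intro: finite_PiE)

lemma less_fun_linear_indices:
  assumes "a \<in> indices n r" "b \<in> indices n r"
  shows "less_fun a b \<or> a = b \<or> less_fun b a"
proof (rule less_fun_trichotomy)
  have "{k. a k \<noteq> b k} \<subseteq> {1..n}"
  proof
    fix k
    assume k: "k \<in> {k. a k \<noteq> b k}"
    show "k \<in> {1..n}"
    proof (rule ccontr)
      assume "k \<notin> {1..n}"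
      then have "a k = undefined" "b k = undefined"
        using assms[unfolded indices_def] by (blast intro: PiE_arb)+
      then show False
        using k by simp
    qed
  qed
  then show "finite {k. a k \<noteq> b k}"
    by (rule finite_subset) simp
qed

lemma ex_less_fun_greatest:
  assumes "finite A" "A \<noteq> {}" "A \<subseteq> indices n r"
  shows "\<exists>b\<in>A. \<forall>c\<in>A. c = b \<or> less_fun c b"
  using assms
proof (induction A rule: finite_ne_induct)
  case (singleton x)
  then show ?case by simp
next
  case (insert x F)
  then obtain b where b: "b \<in> F" "\<forall>c\<in>F. c = b \<or> less_fun c b" by auto
  have "less_fun x b \<or> x = b \<or> less_fun b x"
    using insert.prems b(1) by (intro less_fun_linear_indices) auto
  then show ?case
  proof (elim disjE)
    assume "less_fun b x"
    then have "\<forall>c\<in>insert x F. c = x \<or> less_fun c x"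
      using b(2) less_fun_trans[OF _ \<open>less_fun b x\<close>] by auto
    then show ?thesis by (intro bexI[of _ x]) simp_all
  qed (use b in auto)
qed

lemma normal_form:
  assumes "a \<in> indices n r"
  shows "(a, normal_form n r s a) \<in> s_equiv n r s \<and>
    (\<forall>c. (a, c) \<in> s_equiv n r s \<longrightarrow> c = normal_form n r s a \<or> less_fun c (normal_form n r s a))"
proof -
  let ?A = "s_equiv n r s `` {a}"
  have sub: "?A \<subseteq> indices n r" by (auto simp: s_equiv_def)
  have "a \<in> ?A" using assms by (auto simp: s_equiv_def)
  then obtain b where "b \<in> ?A" "\<forall>c\<in>?A. c = b \<or> less_fun c b"
    using ex_less_fun_greatest[of ?A n r] sub finite_subset[OF sub finite_indices] by blast
  then have b: "(a, b) \<in> s_equiv n r s" "\<And>c. (a, c) \<in> s_equiv n r s \<Longrightarrow> c = b \<or> less_fun c b"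
    by simp_all
  have "\<exists>!b. (a, b) \<in> s_equiv n r s \<and>
      (\<forall>c. (a, c) \<in> s_equiv n r s \<longrightarrow> c = b \<or> less_fun c b)"
  proof (rule ex1I[of _ b])
    show "(a, b) \<in> s_equiv n r s \<and>
        (\<forall>c. (a, c) \<in> s_equiv n r s \<longrightarrow> c = b \<or> less_fun c b)"
      using b by simp
  next
    fix b'
    assume b': "(a, b') \<in> s_equiv n r s \<and>
        (\<forall>c. (a, c) \<in> s_equiv n r s \<longrightarrow> c = b' \<or> less_fun c b')"
    then have "b' = b \<or> less_fun b' b" "b = b' \<or> less_fun b b'"
      using b by simp_all
    then show "b' = b"
      using less_fun_asym[of b b'] by auto
  qed
  from theI'[OF this] show ?thesis
    unfolding normal_form_def .
qed

lemma normal_form_cong: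
  assumes "(a, b) \<in> s_equiv n r s"
  shows "normal_form n r s a = normal_form n r s b"
proof -
  have "(a, c) \<in> s_equiv n r s \<longleftrightarrow> (b, c) \<in> s_equiv n r s" for c
    using assms equiv_s_equiv[of n r s] by (auto simp: s_equiv_def)
  then show ?thesis by (simp add: normal_form_def)
qed

lemma var_less_iff:
  assumes "a \<in> indices n r" "b \<in> indices n r"
  shows "var_less n r s (var_class n r s a) (var_class n r s b) \<longleftrightarrow>
    less_fun (normal_form n r s a) (normal_form n r s b)"
proof
  assume "var_less n r s (var_class n r s a) (var_class n r s b)"
  then obtain a' b' where *: "a' \<in> indices n r" "b' \<in> indices n r"
      "var_class n r s a = var_class n r s a'" "var_class n r s b = var_class n r s b'"
      "less_fun (normal_form n r s a') (normal_form n r s b')"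
    unfolding var_less_def by blast
  have "normal_form n r s a = normal_form n r s a'" "normal_form n r s b = normal_form n r s b'"
    using var_class_eq_iff assms * by (blast intro: normal_form_cong)+
  then show "less_fun (normal_form n r s a) (normal_form n r s b)"
    using * by simp
next
  assume "less_fun (normal_form n r s a) (normal_form n r s b)"
  then show "var_less n r s (var_class n r s a) (var_class n r s b)"
    unfolding var_less_def using assms by blast
qed

end

theory Submission
  imports Defs
begin

text \<open>
  Up to \<open>s\<close>-equivalence an index is its norm \<open>N\<close>, the sum of its first \<open>s\<close> components, followed by its
  components at positions above \<open>s\<close>, and the variable order compares \<open>N\<close> first and then these
  components lexicographically. Moreover \<open>S\<close> is closed under all switches \<open>sw K a b\<close> with
  \<open>K \<subseteq> {1..t}\<close>, not only under those of a single position between indices of distance 2: this is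
  where connectedness enters (\<open>sw_closed\<close>).

  The conditions are necessary because each of them equates, for the two monomials, sums of the form
  \<open>\<Sum> h (a\<^sub>j)\<close>, where \<open>h\<close> is constant on variables and \<open>h a + h b\<close> is unchanged by a switch. So \<open>h\<close>
  defines a grading in which every element of \<open>G_set\<close> is homogeneous, and a reduction step preserves
  the sum of the coefficients in each degree (\<open>reduces_to_zero_imp_invariant_eq\<close>).

  For sufficiency, view a monomial as a multiset of indices. If two of its members can be replaced, up
  to \<open>s\<close>-equivalence, by switching, in such a way that the largest variable involved disappears, then
  an element of \<open>G_set\<close> has the corresponding leading term. These replacements terminate and preserve
  the conditions, so it is enough to see that an irreducible multiset is determined by its invariants
  (\<open>irreducible_unique\<close>). Split an index into blocks: the norm \<open>N\<close>, then each position in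
  \<open>{s+1..t}\<close> by itself, and finally the remaining positions together. Irreducibility forces
  two things:

  \<^item> Norms of two members differ by at most 1. Otherwise representatives can be chosen for which
    switching position 1 moves the two norms strictly inside the interval that they span
    (\<open>irreducible_norm_balanced\<close>). Hence the multiset of norms is determined by its size and sum.

  \<^item> If \<open>a\<close> exceeds \<open>b\<close> on an initial sequence of blocks, then the next block of \<open>a\<close> is at most that
    of \<open>b\<close>. Otherwise switch this block alone (\<open>irreducible_digit_antitone\<close>). The final block is not
    switchable, but switching everything else has the same effect up to exchanging the two results;
    for the norms this uses that they differ by at most 1, so that there are representatives that
    agree on the first \<open>s\<close> positions except for such a difference at position 1
    (\<open>irreducible_tail_antitone\<close>).

  The second property says that the initial sequences and the next blocks are paired in opposite
  orders, and such a pairing is determined by its two marginals (\<open>antitone_coupling_eqI\<close>). Induction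
  over the blocks then recovers the multiset of variables.
\<close>


section \<open>Multisets\<close>

text \<open>The two maxima agree: if the maximum \<open>y\<close> of one multiset exceeded all of the other, then the other
  would have all entries at most \<open>y - 1\<close>, while the first has all entries at least \<open>y - 1\<close> and
  contains \<open>y\<close>, so the sums would differ.\<close>

lemma balanced_mset_eqI:
  fixes A A' :: "nat multiset"
  assumes "size A = size A'" and "\<Sum>\<^sub># A = \<Sum>\<^sub># A'"
    and "\<And>x y. x \<in># A \<Longrightarrow> y \<in># A \<Longrightarrow> x \<le> Suc y"
    and "\<And>x y. x \<in># A' \<Longrightarrow> y \<in># A' \<Longrightarrow> x \<le> Suc y"
  shows "A = A'"
  using assms
proof (induction "size A" arbitrary: A A')
  case 0
  then show ?case by simp
next
  case (Suc k)
  have bound: "Max (set_mset C) \<le> Max (set_mset D)"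
    if C: "C \<noteq> {#}" and sz: "size C = size D" and sm: "\<Sum>\<^sub># C = \<Sum>\<^sub># D"
      and bal: "\<And>x y. x \<in># C \<Longrightarrow> y \<in># C \<Longrightarrow> x \<le> Suc y" for C D :: "nat multiset"
  proof (rule ccontr)
    assume neg: "\<not> Max (set_mset C) \<le> Max (set_mset D)"
    define y where "y = Max (set_mset C)"
    have yC: "y \<in># C" unfolding y_def using C by (intro Max_in) auto
    have D: "x \<le> y - 1" if "x \<in># D" for x
    proof -
      have "x \<le> Max (set_mset D)" using that by simp
      then show ?thesis using neg unfolding y_def by linarith
    qed
    obtain C' where C': "C = add_mset y C'" using yC by (metis mset_add)
    have "x \<ge> y - 1" if "x \<in># C'" for x
      using bal[of y x] yC that C' by auto
    then have "size C' * (y - 1) \<le> \<Sum>\<^sub># C'"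
      by (induction C') (auto simp: add_mono)
    moreover have "\<Sum>\<^sub># D \<le> size D * (y - 1)"
      using D by (induction D) (auto simp: add_mono)
    moreover have "y > 0" using neg unfolding y_def by simp
    moreover have "size D * (y - 1) = (y - 1) + size C' * (y - 1)"
      using sz by (simp add: C' flip: sz)
    ultimately show False using sm by (simp add: C')
  qed
  have ne: "A \<noteq> {#}" "A' \<noteq> {#}" using Suc by auto
  then have eq: "Max (set_mset A) = Max (set_mset A')"
    using bound[of A A'] bound[of A' A] Suc.prems by (metis le_antisym)
  define y where "y = Max (set_mset A)"
  have "y \<in># A" "y \<in># A'"
    using ne eq Max_in[of "set_mset A"] Max_in[of "set_mset A'"] unfolding y_def by auto
  then obtain B B' where B: "A = add_mset y B" "A' = add_mset y B'" by (metis mset_add)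
  have "B = B'"
    by (rule Suc.hyps(1)) (use Suc.hyps(2) Suc.prems B in auto)
  then show ?case using B by simp
qed

text \<open>The largest first component \<open>x\<close> is paired with the smallest second component \<open>y\<close>: in a pair with
  first component below \<open>x\<close>, the second is no smaller than any that goes with \<open>x\<close>. So the pair
  \<open>(x, y)\<close> occurs in both multisets and can be removed from both.\<close>

lemma antitone_coupling_eqI:
  fixes P P' :: "('x::linorder \<times> 'y::linorder) multiset"
  assumes "image_mset fst P = image_mset fst P'" and "image_mset snd P = image_mset snd P'"
    and "\<And>p q. p \<in># P \<Longrightarrow> q \<in># P \<Longrightarrow> fst p > fst q \<Longrightarrow> snd p \<le> snd q"
    and "\<And>p q. p \<in># P' \<Longrightarrow> q \<in># P' \<Longrightarrow> fst p > fst q \<Longrightarrow> snd p \<le> snd q"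
  shows "P = P'"
  using assms
proof (induction "size P" arbitrary: P P')
  case 0
  then show ?case by (metis image_mset_is_empty_iff size_eq_0_iff_empty)
next
  case (Suc k)
  define x where "x = Max (fst ` set_mset P)"
  define y where "y = Min (snd ` set_mset P)"
  have img: "fst ` set_mset P' = fst ` set_mset P" "snd ` set_mset P' = snd ` set_mset P"
    using Suc.prems(1,2) by (metis set_image_mset)+
  have corner: "(Max (fst ` set_mset Q), Min (snd ` set_mset Q)) \<in># Q"
    if ne: "Q \<noteq> {#}" and anti: "\<And>p q. p \<in># Q \<Longrightarrow> q \<in># Q \<Longrightarrow> fst p > fst q \<Longrightarrow> snd p \<le> snd q"
    for Q :: "('x \<times> 'y) multiset"
  proof -
    have "Max (fst ` set_mset Q) \<in> fst ` set_mset Q" using ne by (intro Max_in) auto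
    then obtain p where p: "p \<in># Q" "fst p = Max (fst ` set_mset Q)" by auto
    have "Min (snd ` set_mset Q) \<in> snd ` set_mset Q" using ne by (intro Min_in) auto
    then obtain q where q: "q \<in># Q" "snd q = Min (snd ` set_mset Q)" by auto
    have "fst q \<le> fst p" using q(1) p(2) by auto
    then consider "fst q = fst p" | "fst q < fst p" by fastforce
    then show ?thesis
    proof cases
      case 1
      then show ?thesis using p q by (metis prod.collapse)
    next
      case 2
      have "snd p \<le> snd q" using anti[OF p(1) q(1) 2] .
      moreover have "snd q \<le> snd p" using q(2) p(1) by auto
      ultimately show ?thesis using p q by (metis antisym prod.collapse)
    qed
  qed
  have "P \<noteq> {#}" using Suc.hyps(2) by auto
  moreover have "P' \<noteq> {#}" using calculation Suc.prems(1) by auto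
  ultimately have "(x, y) \<in># P" "(x, y) \<in># P'"
    using corner[of P] corner[of P'] Suc.prems(3,4) unfolding x_def y_def img by blast+
  then obtain Q Q' where Q: "P = add_mset (x, y) Q" "P' = add_mset (x, y) Q'"
    by (metis mset_add)
  have "Q = Q'"
    by (rule Suc.hyps(1)) (use Suc.hyps(2) Suc.prems Q in auto)
  then show ?case using Q by simp
qed

lemma sum_mset_of_bool_eq_count:
  "(\<Sum>x\<in>#M. of_bool (f x = v)) = count (image_mset f M) v"
  by (induction M) auto

text \<open>The sums of the integer points of a box fill an interval; this supplies the representatives of
  \<open>s\<close>-equivalence classes with prescribed bounds on their components.\<close>

lemma ex_box_sum:
  fixes lo hi :: "'i \<Rightarrow> nat"
  assumes "finite I" and "\<And>i. i \<in> I \<Longrightarrow> lo i \<le> hi i"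
    and "sum lo I \<le> N" and "N \<le> sum hi I"
  obtains f where "\<And>i. i \<in> I \<Longrightarrow> lo i \<le> f i \<and> f i \<le> hi i" and "sum f I = N"
proof -
  have "\<exists>f. (\<forall>i\<in>I. lo i \<le> f i \<and> f i \<le> hi i) \<and> sum f I = N"
    using assms
  proof (induction I arbitrary: N rule: finite_induct)
    case empty
    then show ?case by simp
  next
    case (insert x F)
    define v where "v = min (hi x) (N - sum lo F)"
    have v: "lo x \<le> v" "v \<le> hi x" "v \<le> N"
      using insert by (auto simp: v_def)
    have le: "sum lo F \<le> sum hi F" using insert.prems(1) by (intro sum_mono) auto
    have "\<exists>f. (\<forall>i\<in>F. lo i \<le> f i \<and> f i \<le> hi i) \<and> sum f F = N - v"
      using insert le by (intro insert.IH) (auto simp: v_def)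
    then obtain f where f: "\<forall>i\<in>F. lo i \<le> f i \<and> f i \<le> hi i" "sum f F = N - v" by blast
    have "sum (f(x := v)) F = sum f F"
      using insert.hyps by (intro sum.cong) auto
    then show ?case
      using insert.hyps f v by (intro exI[of _ "f(x := v)"]) auto
  qed
  then show ?thesis using that by blast
qed

section \<open>Lexicographic comparison by numbers\<close>

text \<open>The number with leading part \<open>x\<close> and base-\<open>B\<close> digits \<open>a (l + 1), \<dots>, a (l + m)\<close>. Comparing such
  numbers is comparing lexicographically, which turns initial sequences of blocks into elements of a
  linearly ordered type.\<close>

primrec lexcode :: "nat \<Rightarrow> nat \<Rightarrow> nat \<Rightarrow> index \<Rightarrow> nat \<Rightarrow> nat" where
  "lexcode B x l a 0 = x"
| "lexcode B x l a (Suc m) = lexcode B x l a m * B + a (l + Suc m)"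

lemma lexcode_add:
  "lexcode B x l a (m + k) = lexcode B (lexcode B x l a m) (l + m) a k"
  by (induction k) (simp_all add: add.assoc)

lemma lexcode_cong:
  assumes "\<And>i. i \<in> {l+1..l+m} \<Longrightarrow> a i = b i"
  shows "lexcode B x l a m = lexcode B x l b m"
  using assms by (induction m) auto

lemma lexcode_head: "lexcode B x l a m = x * B ^ m + lexcode B 0 l a m"
  by (induction m) (simp_all add: algebra_simps)

lemma digit_less_iff:
  fixes u v x y B :: nat
  assumes "u < B" "v < B"
  shows "x * B + u < y * B + v \<longleftrightarrow> x < y \<or> x = y \<and> u < v"
proof -
  have less: "x * B + u < y * B + v" if "x < y" "u < B" for x y u v :: nat
  proof -
    have "Suc x * B \<le> y * B" using that by (intro mult_right_mono) auto
    then show ?thesis using that by simp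
  qed
  consider "x < y" | "x = y" | "y < x" by linarith
  then show ?thesis
    using less[of x y u v] less[of y x v u] assms by cases auto
qed

text \<open>Both equivalences are proved in one induction, since the comparison of longer codes needs the
  equality of shorter ones.\<close>

lemma lexcode_less_iff:
  assumes "\<And>i. i \<in> {l+1..l+m} \<Longrightarrow> a i < B" "\<And>i. i \<in> {l+1..l+m} \<Longrightarrow> b i < B"
  shows "(lexcode B x l a m < lexcode B y l b m \<longleftrightarrow>
      x < y \<or> x = y \<and> (\<exists>i\<in>{l+1..l+m}. a i < b i \<and> (\<forall>j\<in>{l+1..<i}. a j = b j))) \<and>
    (lexcode B x l a m = lexcode B y l b m \<longleftrightarrow> x = y \<and> (\<forall>i\<in>{l+1..l+m}. a i = b i))"
  using assms
proof (induction m)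
  case 0
  then show ?case by simp
next
  case (Suc m)
  have IH: "lexcode B x l a m < lexcode B y l b m \<longleftrightarrow>
      x < y \<or> x = y \<and> (\<exists>i\<in>{l+1..l+m}. a i < b i \<and> (\<forall>j\<in>{l+1..<i}. a j = b j))"
    "lexcode B x l a m = lexcode B y l b m \<longleftrightarrow> x = y \<and> (\<forall>i\<in>{l+1..l+m}. a i = b i)"
    using Suc by auto
  have set: "{l+1..l+Suc m} = insert (l + Suc m) {l+1..l+m}" "{l+1..<l+Suc m} = {l+1..l+m}"
    by auto
  have dig: "a (l + Suc m) < B" "b (l + Suc m) < B" using Suc.prems by auto
  have less: "lexcode B x l a (Suc m) < lexcode B y l b (Suc m) \<longleftrightarrow>
      lexcode B x l a m < lexcode B y l b m \<or>
      lexcode B x l a m = lexcode B y l b m \<and> a (l + Suc m) < b (l + Suc m)"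
    using digit_less_iff[OF dig] by simp
  have gr: "lexcode B y l b (Suc m) < lexcode B x l a (Suc m) \<longleftrightarrow>
      lexcode B y l b m < lexcode B x l a m \<or>
      lexcode B y l b m = lexcode B x l a m \<and> b (l + Suc m) < a (l + Suc m)"
    using digit_less_iff[OF dig(2,1)] by simp
  have eq: "lexcode B x l a (Suc m) = lexcode B y l b (Suc m) \<longleftrightarrow>
      lexcode B x l a m = lexcode B y l b m \<and> a (l + Suc m) = b (l + Suc m)"
    using less gr by (metis linorder_neq_iff)
  show ?case
    unfolding less eq IH set bex_simps ball_simps by (auto simp: set)
qed

section \<open>Linear functionals on polynomials\<close>

text \<open>The linear functional with value \<open>\<phi> m\<close> at the basis element \<open>m\<close>. It is used for the degree of a
  monomial in a grading and for the sum of the coefficients of a polynomial in one degree.\<close>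

definition weighted_sum :: "('a \<Rightarrow> 'b) \<Rightarrow> ('a \<Rightarrow>\<^sub>0 'b) \<Rightarrow> 'b::comm_semiring_0" where
  "weighted_sum \<phi> p = (\<Sum>m\<in>Poly_Mapping.keys p. Poly_Mapping.lookup p m * \<phi> m)"

lemma weighted_sum_superset:
  assumes "finite A" "Poly_Mapping.keys p \<subseteq> A"
  shows "weighted_sum \<phi> p = (\<Sum>m\<in>A. Poly_Mapping.lookup p m * \<phi> m)"
  unfolding weighted_sum_def using assms
  by (intro sum.mono_neutral_left) (auto simp: in_keys_iff)

lemma weighted_sum_add: "weighted_sum \<phi> (p + q) = weighted_sum \<phi> p + weighted_sum \<phi> q"
proof -
  let ?A = "Poly_Mapping.keys p \<union> Poly_Mapping.keys q"
  have "Poly_Mapping.keys (p + q) \<subseteq> ?A" by (rule Poly_Mapping.keys_add)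
  then show ?thesis
    by (simp add: weighted_sum_superset[of ?A] lookup_add distrib_right sum.distrib)
qed

lemma weighted_sum_zero: "weighted_sum \<phi> 0 = 0"
  by (simp add: weighted_sum_def)

lemma weighted_sum_diff:
  fixes p q :: "'a \<Rightarrow>\<^sub>0 'b::comm_ring"
  shows "weighted_sum \<phi> (p - q) = weighted_sum \<phi> p - weighted_sum \<phi> q"
  using weighted_sum_add[of \<phi> "p - q" q] by simp

lemma weighted_sum_single: "weighted_sum \<phi> (Poly_Mapping.single m c) = c * \<phi> m"
  by (simp add: weighted_sum_def)

section \<open>Monomials and invariants\<close>

definition monom_of :: "nat \<Rightarrow> (nat \<Rightarrow> nat) \<Rightarrow> nat \<Rightarrow> index multiset \<Rightarrow> monom" where
  "monom_of n r s M = (\<Sum>a\<in>#M. Poly_Mapping.single (var_class n r s a) 1)"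

lemma monom_of_simps [simp]:
  "monom_of n r s {#} = 0"
  "monom_of n r s (add_mset a M) = Poly_Mapping.single (var_class n r s a) 1 + monom_of n r s M"
  "monom_of n r s (M + M') = monom_of n r s M + monom_of n r s M'"
  by (simp_all add: monom_of_def)

lemma prod_X:
  "(\<Prod>j\<in>J. X n r s (a j)) =
    (Poly_Mapping.single (monom_of n r s (image_mset a (mset_set J))) 1 :: 'k::field poly)"
  by (induction J rule: infinite_finite_induct) (simp_all add: X_def mult_single)

lemma f_poly_eq:
  "(f_poly n r s L a b :: 'k::field poly) =
    Poly_Mapping.single (monom_of n r s {#a, b#}) 1 -
    Poly_Mapping.single (monom_of n r s {#sw L a b, sw L b a#}) 1"
  by (simp add: f_poly_def X_def mult_single)

lemma sw_apply: "sw L a b i = (if i \<in> L then b i else a i)"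
  by (simp add: sw_def override_on_def)

lemma indices_bounds:
  assumes "a \<in> indices n r" "i \<in> {1..n}"
  shows "1 \<le> a i" "a i \<le> r i"
  using assms unfolding indices_def by (metis PiE_mem atLeastAtMost_iff)+

lemma indicesI:
  assumes "\<And>i. i \<in> {1..n} \<Longrightarrow> 1 \<le> a i \<and> a i \<le> r i" "\<And>i. i \<notin> {1..n} \<Longrightarrow> a i = undefined"
  shows "a \<in> indices n r"
  using assms unfolding indices_def by (intro PiE_I) auto

lemma indices_undefined:
  assumes "a \<in> indices n r" "i \<notin> {1..n}"
  shows "a i = undefined"
  using assms unfolding indices_def by (rule PiE_arb)

lemma sw_in_indices:
  assumes "a \<in> indices n r" "b \<in> indices n r"
  shows "sw L a b \<in> indices n r"
  using indices_bounds[OF assms(1)] indices_bounds[OF assms(2)]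
    indices_undefined[OF assms(1)] indices_undefined[OF assms(2)]
  by (intro indicesI) (auto simp: sw_apply)

text \<open>The function \<open>h\<close> grades the polynomial ring, and the elements of \<^const>\<open>G_set\<close> are differences of two
  monomials of equal degree. Hence a reduction step does not change the sum of the coefficients in
  any degree, and this sum is 0 at the end of the reduction. In the degree of the first monomial this
  sum would be 1 if the second one had a different degree.\<close>

lemma reduces_to_zero_imp_invariant_eq:
  fixes h :: "index \<Rightarrow> nat"
  assumes sub: "S \<subseteq> indices n r"
    and cong: "\<And>a b. (a, b) \<in> s_equiv n r s \<Longrightarrow> h a = h b"
    and switch: "\<And>K a b. K \<subseteq> {1..t} \<Longrightarrow> a \<in> S \<Longrightarrow> b \<in> S \<Longrightarrow> h (sw K a b) + h (sw K b a) = h a + h b"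
    and M: "set_mset M \<subseteq> indices n r" "set_mset M' \<subseteq> indices n r"
    and red: "reduces_to_zero n r s (G_set n r s t S)
      (Poly_Mapping.single (monom_of n r s M) 1 - Poly_Mapping.single (monom_of n r s M') 1 :: 'k::field poly)"
  shows "(\<Sum>a\<in>#M. h a) = (\<Sum>a\<in>#M'. h a)"
proof -
  \<comment> \<open>A variable is a set of indices on which \<open>h\<close> is constant, so any choice of a member serves.\<close>
  define deg where "deg = weighted_sum (\<lambda>v. h (SOME a. a \<in> v))"
  have deg_monom: "deg (monom_of n r s A) = (\<Sum>a\<in>#A. h a)" if "set_mset A \<subseteq> indices n r" for A
    using that
  proof (induction A)
    case empty
    then show ?case by (simp add: deg_def weighted_sum_zero)
  next
    case (add a A)
    have "a \<in> var_class n r s a" using add.prems by (auto simp: var_class_def s_equiv_def)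
    then have "(SOME x. x \<in> var_class n r s a) \<in> var_class n r s a" by (rule someI[where P = "\<lambda>x. x \<in> var_class n r s a"])
    then have "h a = h (SOME x. x \<in> var_class n r s a)"
      using cong unfolding var_class_def by blast
    then show ?case using add by (simp add: deg_def weighted_sum_add weighted_sum_single)
  qed
  define \<chi> where "\<chi> p = weighted_sum (\<lambda>m. of_bool (deg m = deg (monom_of n r s M))) p" for p :: "'k poly"
  have \<chi>_step: "\<chi> q = \<chi> p" if step: "red_step n r s (G_set n r s t S) p q" for p q :: "'k poly"
  proof -
    obtain K a b u c where K: "K \<subseteq> {1..t}" "a \<in> S" "b \<in> S"
      and q: "q = p - Poly_Mapping.single u c * f_poly n r s K a b"
      using step unfolding red_step_def G_set_def by blast
    have in_ind: "a \<in> indices n r" "b \<in> indices n r" using K sub by auto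
    have "deg (monom_of n r s {#a, b#}) = deg (monom_of n r s {#sw K a b, sw K b a#})"
      using in_ind sw_in_indices[OF in_ind] sw_in_indices[OF in_ind(2,1)] switch[OF K]
      by (subst (1 2) deg_monom) auto
    then have "deg (u + monom_of n r s {#a, b#}) = deg (u + monom_of n r s {#sw K a b, sw K b a#})"
      unfolding deg_def weighted_sum_add by simp
    then show ?thesis
      unfolding q f_poly_eq \<chi>_def
      by (simp add: weighted_sum_diff weighted_sum_single right_diff_distrib mult_single)
  qed
  define p :: "'k poly" where "p = Poly_Mapping.single (monom_of n r s M) 1 - Poly_Mapping.single (monom_of n r s M') 1"
  have "(red_step n r s (G_set n r s t S))\<^sup>*\<^sup>* p q \<Longrightarrow> \<chi> q = \<chi> p" for q
    by (induction rule: rtranclp_induct) (auto dest: \<chi>_step)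
  then have "\<chi> p = \<chi> 0"
    using red unfolding reduces_to_zero_def p_def by metis
  then have "deg (monom_of n r s M') = deg (monom_of n r s M)"
    unfolding \<chi>_def p_def by (simp add: weighted_sum_diff weighted_sum_single weighted_sum_zero split: if_splits)
  then show ?thesis using deg_monom M by simp
qed

lemma red_step_uminus:
  fixes p q :: "'k::field poly"
  assumes "red_step n r s G p q"
  shows "red_step n r s G (- p) (- q)"
proof -
  obtain g m u where *: "g \<in> G" "is_leading_monom n r s g m" "u + m \<in> Poly_Mapping.keys p"
    "q = p - Poly_Mapping.single u (Poly_Mapping.lookup p (u + m) / Poly_Mapping.lookup g m) * g"
    using assms unfolding red_step_def by blast
  have "- q = - p - Poly_Mapping.single u (Poly_Mapping.lookup (- p) (u + m) / Poly_Mapping.lookup g m) * g"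
    unfolding *(4) by (simp add: single_uminus)
  then show ?thesis unfolding red_step_def using * by (metis keys_minus)
qed

text \<open>This allows the first monomial of a binomial to be reduced instead of the second.\<close>

lemma reduces_to_zero_uminus:
  fixes p :: "'k::field poly"
  assumes "reduces_to_zero n r s G p"
  shows "reduces_to_zero n r s G (- p)"
proof -
  have "(red_step n r s G)\<^sup>*\<^sup>* p q \<Longrightarrow> (red_step n r s G)\<^sup>*\<^sup>* (- p) (- q)" for q
    by (induction rule: rtranclp_induct) (auto dest: red_step_uminus intro: rtranclp.rtrancl_into_rtrancl)
  from this[of 0] show ?thesis using assms unfolding reduces_to_zero_def by simp
qed

section \<open>Connected switchable sets\<close>

locale connected_switchable =
  fixes n s t :: nat and r :: "nat \<Rightarrow> nat" and S :: "index set"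
  assumes r_ge2: "\<And>i. i \<in> {1..n} \<Longrightarrow> r i \<ge> 2"
    and s_range: "s \<in> {1..n}" "s \<ge> 2"
    and t_range: "t \<in> {1..n}"
    and connected: "connected_indices n S"
    and switchable: "switchable n r s t S"
begin

lemma S_indices: "a \<in> S \<Longrightarrow> a \<in> indices n r"
  using switchable unfolding switchable_def by blast

lemma s_equiv_closed: "a \<in> S \<Longrightarrow> (a, b) \<in> s_equiv n r s \<Longrightarrow> b \<in> S"
  using switchable unfolding switchable_def by blast

text \<open>Induction on the length of a path from \<open>a\<close> to \<open>b\<close>. The rest of the path, from \<open>c 1\<close> on, gives
  \<open>e = sw {i} (c 1) b\<close> in \<open>S\<close>. As \<open>c 0\<close> and \<open>c 1\<close> differ in one position \<open>j\<close> only, \<open>c 0\<close> and \<open>e\<close>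
  differ at most in \<open>i\<close> and \<open>j\<close>. Either the desired index is \<open>c 0\<close> or \<open>e\<close> itself, or the distance is
  2 and switchability applies.\<close>

lemma sw_single_closed:
  assumes i: "i \<in> {1..t}" and ab: "a \<in> S" "b \<in> S"
  shows "sw {i} a b \<in> S"
proof -
  have path: "sw {i} (c 0) (c k) \<in> S"
    if "\<forall>j\<le>k. c j \<in> S" "\<forall>j\<in>{1..k}. distance n (c (j - 1)) (c j) = 1" for k :: nat and c
    using that
  proof (induction k arbitrary: c)
    case 0
    then show ?case by (simp add: sw_def override_on_def)
  next
    case (Suc k)
    define e where "e = sw {i} (c 1) (c (Suc k))"
    have e: "e \<in> S"
    proof -
      have "sw {i} (c (Suc 0)) (c (Suc k)) \<in> S"
      proof (rule Suc.IH[of "\<lambda>j. c (Suc j)"])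
        show "\<forall>j\<in>{1..k}. distance n (c (Suc (j - 1))) (c (Suc j)) = 1"
          using Suc.prems(2) by (metis (no_types, lifting) Suc_diff_1 Suc_le_mono atLeastAtMost_iff diff_Suc_1 le_SucI less_eq_Suc_le One_nat_def)
      qed (use Suc.prems in auto)
      then show ?thesis by (simp add: e_def)
    qed
    have "distance n (c 0) (c 1) = 1"
      using Suc.prems(2)[rule_format, of 1] by simp
    then obtain j where j: "{x\<in>{1..n}. c 0 x \<noteq> c 1 x} = {j}"
      unfolding distance_def by (meson card_1_singletonE)
    have ind: "c 0 \<in> indices n r" "c 1 \<in> indices n r" "c (Suc k) \<in> indices n r"
      using Suc.prems(1) by (auto intro: S_indices)
    have same: "c 0 x = c 1 x" if "x \<noteq> j" for x
      using j that indices_undefined[OF ind(1), of x] indices_undefined[OF ind(2), of x] by fastforce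
    consider "j = i" | "c (Suc k) i = c 0 i" | "j \<noteq> i" "c (Suc k) i \<noteq> c 0 i" by blast
    then show ?case
    proof cases
      case 1
      then have "sw {i} (c 0) (c (Suc k)) = e"
        using same by (auto simp: e_def sw_apply)
      then show ?thesis using e by simp
    next
      case 2
      then have "sw {i} (c 0) (c (Suc k)) = c 0"
        by (auto simp: sw_apply)
      then show ?thesis using Suc.prems(1) by simp
    next
      case 3
      have "{x\<in>{1..n}. c 0 x \<noteq> e x} = {i, j}"
        using 3 j same i t_range by (auto simp: e_def sw_apply)
      then have "distance n (c 0) e = 2"
        using 3(1) by (simp add: distance_def)
      then have "sw {i} (c 0) e \<in> S"
        using switchable e i Suc.prems(1) unfolding switchable_def by blast
      moreover have "sw {i} (c 0) e = sw {i} (c 0) (c (Suc k))"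
        by (auto simp: e_def sw_apply)
      ultimately show ?thesis by simp
    qed
  qed
  obtain k c where "c 0 = a" "c (k::nat) = b" "\<forall>j\<le>k. c j \<in> S"
    "\<forall>j\<in>{1..k}. distance n (c (j - 1)) (c j) = 1"
    using connected ab unfolding connected_indices_def connected_in_def by blast
  then show ?thesis using path[of k c] by simp
qed

lemma sw_closed:
  assumes "K \<subseteq> {1..t}" "a \<in> S" "b \<in> S"
  shows "sw K a b \<in> S"
proof -
  have "finite K" using assms(1) by (rule finite_subset) simp
  then show ?thesis using assms
  proof (induction K rule: finite_induct)
    case empty
    then show ?case by (simp add: sw_def)
  next
    case (insert i K)
    have "sw (insert i K) a b = sw {i} (sw K a b) b" by (auto simp: sw_apply)
    then show ?case using insert sw_single_closed[of i "sw K a b" b] by simp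
  qed
qed

lemma norm_upto_cong: "(\<And>i. i \<in> {1..s} \<Longrightarrow> a i = b i) \<Longrightarrow> norm_upto s a = norm_upto s b"
  unfolding norm_upto_def by (intro sum.cong) auto

lemma s_equiv_iff:
  assumes "a \<in> indices n r" "b \<in> indices n r"
  shows "(a, b) \<in> s_equiv n r s \<longleftrightarrow> norm_upto s a = norm_upto s b \<and> (\<forall>i\<in>{s+1..n}. a i = b i)"
  using assms by (simp add: s_equiv_def norm_upto_def)

lemma s_equiv_head:
  assumes a: "a \<in> indices n r" and h: "\<And>i. i \<in> {1..s} \<Longrightarrow> 1 \<le> h i \<and> h i \<le> r i"
    and sum: "norm_upto s h = norm_upto s a"
  shows "(a, sw {1..s} a h) \<in> s_equiv n r s"
proof -
  have "sw {1..s} a h \<in> indices n r"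
    using indices_bounds[OF a] indices_undefined[OF a] h s_range by (intro indicesI) (auto simp: sw_apply)
  moreover have "norm_upto s (sw {1..s} a h) = norm_upto s h"
    by (intro norm_upto_cong) (simp add: sw_apply)
  ultimately show ?thesis using a sum by (subst s_equiv_iff) (auto simp: sw_apply)
qed

subsection \<open>The variable order\<close>

text \<open>Any bound above all components would do as a base.\<close>

definition base :: nat where "base = Suc (\<Sum>i\<in>{1..n}. r i)"

text \<open>The code of the norm and the \<open>m\<close> components after position \<open>s\<close>. With all components it ranks the
  variables.\<close>

definition code :: "nat \<Rightarrow> index \<Rightarrow> nat" where
  "code m a = lexcode base (norm_upto s a) s a m"

abbreviation "rank \<equiv> code (n - s)"

lemma less_base: "a \<in> indices n r \<Longrightarrow> i \<in> {1..n} \<Longrightarrow> a i < base"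
  using indices_bounds(2)[of a n r i] member_le_sum[of i "{1..n}" r] unfolding base_def by fastforce

lemma code_less_iff:
  assumes "a \<in> indices n r" "b \<in> indices n r" "s + m \<le> n"
  shows "code m a < code m b \<longleftrightarrow> norm_upto s a < norm_upto s b \<or> norm_upto s a = norm_upto s b \<and>
    (\<exists>i\<in>{s+1..s+m}. a i < b i \<and> (\<forall>j\<in>{s+1..<i}. a j = b j))"
  unfolding code_def
  by (rule lexcode_less_iff[THEN conjunct1]) (use assms less_base in auto)

lemma code_eq_iff:
  assumes "a \<in> indices n r" "b \<in> indices n r" "s + m \<le> n"
  shows "code m a = code m b \<longleftrightarrow> norm_upto s a = norm_upto s b \<and> (\<forall>i\<in>{s+1..s+m}. a i = b i)"
  unfolding code_def
  by (rule lexcode_less_iff[THEN conjunct2]) (use assms less_base in auto)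

lemma code_Suc: "code (Suc m) a = code m a * base + a (s + Suc m)"
  by (simp add: code_def)

lemma code_0: "code 0 a = norm_upto s a"
  by (simp add: code_def)

lemma code_less_mono:
  assumes "a \<in> indices n r" "b \<in> indices n r" "m \<le> m'" "s + m' \<le> n" "code m a < code m b"
  shows "code m' a < code m' b"
proof -
  have "s + m \<le> n" using assms by simp
  then show ?thesis
    using assms(5) unfolding code_less_iff[OF assms(1,2,4)] code_less_iff[OF assms(1,2) \<open>s + m \<le> n\<close>]
    using assms(3) by fastforce
qed

lemma rank_eq_iff:
  assumes "a \<in> indices n r" "b \<in> indices n r"
  shows "rank a = rank b \<longleftrightarrow> (a, b) \<in> s_equiv n r s"
  using code_eq_iff[OF assms, of "n - s"] s_range by (simp add: s_equiv_iff[OF assms])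

text \<open>Only the first \<open>s\<close> positions need an argument. Suppose that \<open>\<beta>\<close> is lexicographically smaller because
  of a position \<open>k \<le> s\<close>. Its norm is no smaller than that of \<open>\<alpha>\<close>, so it exceeds \<open>\<alpha>\<close> at some position
  \<open>j\<close> with \<open>k < j \<le> s\<close>. Moving one unit from \<open>j\<close> to \<open>k\<close> gives a lexicographically larger index that
  is \<open>s\<close>-equivalent to \<open>\<beta>\<close>, contrary to the maximality of \<open>\<beta>\<close>.\<close>

lemma lex_less_if_rank_less:
  assumes \<alpha>: "\<alpha> \<in> indices n r" and \<beta>: "\<beta> \<in> indices n r"
    and max: "\<And>c. (\<beta>, c) \<in> s_equiv n r s \<Longrightarrow> \<not> less_fun \<beta> c"
    and less: "rank \<alpha> < rank \<beta>"
  shows "less_fun \<alpha> \<beta>"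
proof (rule ccontr)
  assume "\<not> less_fun \<alpha> \<beta>"
  then have "less_fun \<beta> \<alpha>" using less_fun_linear_indices[OF \<alpha> \<beta>] less by auto
  then obtain k where k: "\<beta> k < \<alpha> k" "\<And>j. j < k \<Longrightarrow> \<beta> j = \<alpha> j"
    unfolding less_fun_def by blast
  have sn: "s + (n - s) \<le> n" using s_range by simp
  have N: "norm_upto s \<alpha> \<le> norm_upto s \<beta>"
    using less unfolding code_less_iff[OF \<alpha> \<beta> sn] by auto
  have kn: "k \<in> {1..n}"
    using k(1) indices_undefined[OF \<alpha>] indices_undefined[OF \<beta>] by force
  show False
  proof (cases "k \<le> s")
    case True
    have "\<exists>j\<in>{1..s}. \<alpha> j < \<beta> j"
    proof (rule ccontr)
      assume "\<not> ?thesis"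
      then have "\<forall>j\<in>{1..s}. \<beta> j \<le> \<alpha> j" by auto
      then have "norm_upto s \<beta> < norm_upto s \<alpha>"
        unfolding norm_upto_def using True k(1) kn by (intro sum_strict_mono_ex1) auto
      then show False using N by simp
    qed
    then obtain j where j: "j \<in> {1..s}" "\<alpha> j < \<beta> j" by blast
    then have kj: "k < j" using k by (metis less_irrefl linorder_neqE_nat not_less_iff_gr_or_eq)
    have jn: "j \<in> {1..n}" using j s_range by auto
    define c where "c = \<beta>(k := \<beta> k + 1, j := \<beta> j - 1)"
    have "c \<in> indices n r"
    proof (rule indicesI)
      fix i assume "i \<in> {1..n}"
      then show "1 \<le> c i \<and> c i \<le> r i"
        using indices_bounds[OF \<beta>, of i] indices_bounds[OF \<alpha> kn] indices_bounds[OF \<alpha> jn] k(1) j kj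
        unfolding c_def by auto
    next
      fix i assume "i \<notin> {1..n}"
      then show "c i = undefined" using indices_undefined[OF \<beta>] kn jn by (auto simp: c_def)
    qed
    moreover have "norm_upto s c = norm_upto s \<beta>"
    proof -
      have "{1..s} = insert k (insert j ({1..s} - {k, j}))" using True kn j by auto
      then have split: "sum f {1..s} = f k + (f j + sum f ({1..s} - {k, j}))" for f :: "nat \<Rightarrow> nat"
        using kj by (metis (no_types, lifting) Diff_iff finite_Diff finite_atLeastAtMost finite_insert insert_iff less_irrefl sum.insert)
      have "sum c ({1..s} - {k, j}) = sum \<beta> ({1..s} - {k, j})"
        by (intro sum.cong) (auto simp: c_def)
      then show ?thesis
        using j kj unfolding norm_upto_def split by (auto simp: c_def)
    qed
    ultimately have "(\<beta>, c) \<in> s_equiv n r s"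
      using \<beta> True j by (subst s_equiv_iff) (auto simp: c_def)
    moreover have "less_fun \<beta> c"
      unfolding less_fun_def using kj by (intro exI[of _ k]) (auto simp: c_def)
    ultimately show False using max by blast
  next
    case False
    have "norm_upto s \<alpha> = norm_upto s \<beta>" using k(2) False by (intro norm_upto_cong) auto
    then have "rank \<beta> < rank \<alpha>"
      unfolding code_less_iff[OF \<beta> \<alpha> sn] using False kn k by (auto intro!: bexI[of _ k])
    then show False using less by simp
  qed
qed

lemma var_less_iff_rank_less:
  assumes a: "a \<in> indices n r" and b: "b \<in> indices n r"
  shows "var_less n r s (var_class n r s a) (var_class n r s b) \<longleftrightarrow> rank a < rank b"
proof -
  have lt: "less_fun (normal_form n r s a) (normal_form n r s b)"
    if a: "a \<in> indices n r" and b: "b \<in> indices n r" and less: "rank a < rank b" for a b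
  proof (rule lex_less_if_rank_less)
    note na = normal_form[OF a, of s] and nb = normal_form[OF b, of s]
    show na': "normal_form n r s a \<in> indices n r" and nb': "normal_form n r s b \<in> indices n r"
      using na nb by (auto simp: s_equiv_def)
    show "rank (normal_form n r s a) < rank (normal_form n r s b)"
      using na nb less rank_eq_iff[OF a na'] rank_eq_iff[OF b nb'] by simp
    fix c assume "(normal_form n r s b, c) \<in> s_equiv n r s"
    then have "(b, c) \<in> s_equiv n r s" using nb by (auto simp: s_equiv_def)
    then show "\<not> less_fun (normal_form n r s b) c"
      using nb by (metis less_fun_asym less_fun_irrefl)
  qed
  show ?thesis
    unfolding var_less_iff[OF a b]
  proof
    assume *: "less_fun (normal_form n r s a) (normal_form n r s b)"
    show "rank a < rank b"
    proof (rule ccontr)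
      assume "\<not> rank a < rank b"
      then consider "rank b < rank a" | "rank a = rank b" by linarith
      then show False
      proof cases
        case 1
        then show False using lt[OF b a] * by (metis less_fun_asym)
      next
        case 2
        then show False
          using * rank_eq_iff[OF a b] normal_form_cong[of a b n r s] by (metis less_fun_irrefl)
      qed
    qed
  qed (use lt a b in blast)
qed

lemma var_class_eq_iff_rank_eq:
  assumes "a \<in> indices n r" "b \<in> indices n r"
  shows "var_class n r s a = var_class n r s b \<longleftrightarrow> rank a = rank b"
  unfolding var_class_eq_iff[OF assms] rank_eq_iff[OF assms] ..

subsection \<open>Rewriting multisets of indices\<close>

text \<open>This is the maximum of \<open>s\<close> and \<open>t\<close> (natural subtraction). It is the last position that can be switched
  or is covered by the norm; the positions beyond it form the final block. Writing it this way covers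
  the cases \<open>s \<le> t\<close> and \<open>s \<ge> t\<close> of the theorem at once, as \<open>{s+1..block_end}\<close> is empty in the second.\<close>

abbreviation "block_end \<equiv> s + (t - s)"

definition tail :: "index \<Rightarrow> nat" where
  "tail a = lexcode base 0 block_end a (n - block_end)"

lemma block_end_le: "s \<le> block_end" "t \<le> block_end" "block_end \<le> n"
  using s_range t_range by auto

lemma rank_tail: "rank a = code (t - s) a * base ^ (n - block_end) + tail a"
proof -
  have "n - s = (t - s) + (n - block_end)" using block_end_le by simp
  then have "rank a = lexcode base (code (t - s) a) block_end a (n - block_end)"
    unfolding code_def by (simp only: lexcode_add)
  then show ?thesis unfolding tail_def by (subst (asm) lexcode_head)
qed

lemma tail_cong: "(\<And>i. i \<in> {block_end+1..n} \<Longrightarrow> a i = b i) \<Longrightarrow> tail a = tail b"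
  unfolding tail_def using block_end_le by (intro lexcode_cong) auto

lemma code_cong:
  assumes "norm_upto s a = norm_upto s b" "\<And>i. i \<in> {s+1..s+m} \<Longrightarrow> a i = b i"
  shows "code m a = code m b"
  unfolding code_def assms(1) by (rule lexcode_cong) (use assms(2) in auto)

text \<open>Passing to \<open>\<alpha>\<close> and \<open>\<beta>\<close> does not change the variables, but it changes the results of a switch.
  Requiring the rank of \<open>a\<close> to be strictly above the other three makes the product of the variables of
  \<open>a\<close> and \<open>b\<close> the leading term of \<open>f_poly n r s K \<alpha> \<beta>\<close>.\<close>

definition rewrite_step :: "index multiset \<Rightarrow> index multiset \<Rightarrow> bool" where
  "rewrite_step M M' \<longleftrightarrow> (\<exists>U K a b \<alpha> \<beta>. M = U + {#a, b#} \<and> M' = U + {#sw K \<alpha> \<beta>, sw K \<beta> \<alpha>#} \<and>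
    K \<subseteq> {1..t} \<and> (a, \<alpha>) \<in> s_equiv n r s \<and> (b, \<beta>) \<in> s_equiv n r s \<and>
    rank b < rank a \<and> rank (sw K \<alpha> \<beta>) < rank a \<and> rank (sw K \<beta> \<alpha>) < rank a)"

definition same_invariants :: "index multiset \<Rightarrow> index multiset \<Rightarrow> bool" where
  "same_invariants M M' \<longleftrightarrow>
    (\<Sum>c\<in>#M. norm_upto s c) = (\<Sum>c\<in>#M'. norm_upto s c) \<and>
    (\<forall>i\<in>{s+1..block_end}. image_mset (\<lambda>c. c i) M = image_mset (\<lambda>c. c i) M') \<and>
    image_mset (\<lambda>c. restrict c {block_end+1..n}) M = image_mset (\<lambda>c. restrict c {block_end+1..n}) M'"

lemma norm_upto_sw: "norm_upto s (sw K a b) + norm_upto s (sw K b a) = norm_upto s a + norm_upto s b"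
  unfolding norm_upto_def sum.distrib[symmetric] by (intro sum.cong) (auto simp: sw_apply)

lemma restrict_sw_tail:
  assumes "K \<subseteq> {1..t}"
  shows "restrict (sw K a b) {block_end+1..n} = restrict a {block_end+1..n}"
  using assms block_end_le(2) by (intro restrict_ext) (auto simp: sw_apply)

lemma rewrite_step_invariants:
  assumes M: "set_mset M \<subseteq> S" and step: "rewrite_step M M'"
  shows "set_mset M' \<subseteq> S \<and> same_invariants M M'"
proof -
  obtain U K a b \<alpha> \<beta> where *: "M = U + {#a, b#}" "M' = U + {#sw K \<alpha> \<beta>, sw K \<beta> \<alpha>#}"
    "K \<subseteq> {1..t}" "(a, \<alpha>) \<in> s_equiv n r s" "(b, \<beta>) \<in> s_equiv n r s"
    using step unfolding rewrite_step_def by blast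
  have "\<alpha> \<in> S" "\<beta> \<in> S" using * M by (auto intro: s_equiv_closed)
  then have "set_mset M' \<subseteq> S" using * M sw_closed[OF *(3)] by auto
  moreover have "norm_upto s \<alpha> = norm_upto s a" "norm_upto s \<beta> = norm_upto s b"
    and later: "i \<in> {s+1..n} \<Longrightarrow> \<alpha> i = a i \<and> \<beta> i = b i" for i
    using *(4,5) by (auto simp: s_equiv_def norm_upto_def)
  then have "(\<Sum>c\<in>#M. norm_upto s c) = (\<Sum>c\<in>#M'. norm_upto s c)"
    using norm_upto_sw[of K \<alpha> \<beta>] unfolding *(1,2) by simp
  moreover have "restrict (sw K \<alpha> \<beta>) {block_end+1..n} = restrict a {block_end+1..n}"
    "restrict (sw K \<beta> \<alpha>) {block_end+1..n} = restrict b {block_end+1..n}"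
    unfolding restrict_sw_tail[OF *(3)] using later by (auto intro!: restrict_ext)
  then have "image_mset (\<lambda>c. restrict c {block_end+1..n}) M =
      image_mset (\<lambda>c. restrict c {block_end+1..n}) M'"
    unfolding *(1,2) image_mset_union image_mset_add_mset image_mset_empty by (simp only:)
  moreover have "image_mset (\<lambda>c. c i) M = image_mset (\<lambda>c. c i) M'" if "i \<in> {s+1..block_end}" for i
  proof -
    have "i \<in> {s+1..n}" using that block_end_le(3) by auto
    then show ?thesis unfolding *(1,2) using later[of i] by (simp add: sw_apply add_mset_commute)
  qed
  ultimately show ?thesis unfolding same_invariants_def by (intro conjI ballI)
qed

text \<open>With base 3 the term of the largest variable that is replaced outweighs the terms of the two new
  ones.\<close>

definition weight :: "index multiset \<Rightarrow> nat" where
  "weight M = (\<Sum>a\<in>#M. 3 ^ rank a)"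

lemma rewrite_step_weight:
  assumes "rewrite_step M M'"
  shows "weight M' < weight M"
proof -
  obtain U K a b \<alpha> \<beta> where *: "M = U + {#a, b#}" "M' = U + {#sw K \<alpha> \<beta>, sw K \<beta> \<alpha>#}"
    "rank (sw K \<alpha> \<beta>) < rank a" "rank (sw K \<beta> \<alpha>) < rank a"
    using assms unfolding rewrite_step_def by blast
  have pow: "3 * 3 ^ rank c \<le> (3 :: nat) ^ rank a" if "rank c < rank a" for c
    using that power_increasing[of "Suc (rank c)" "rank a" "3::nat"] by simp
  have "0 < (3::nat) ^ rank a" by simp
  then have "(3::nat) ^ rank (sw K \<alpha> \<beta>) + 3 ^ rank (sw K \<beta> \<alpha>) < 3 ^ rank a + 3 ^ rank b"
    using pow[OF *(3)] pow[OF *(4)] by linarith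
  then show ?thesis by (simp add: weight_def *(1,2))
qed

lemma lookup_monom_of:
  assumes "set_mset M \<subseteq> indices n r" "a \<in> indices n r"
  shows "Poly_Mapping.lookup (monom_of n r s M) (var_class n r s a) = count (image_mset rank M) (rank a)"
  using assms(1)
proof (induction M)
  case (add c M)
  then have "var_class n r s c = var_class n r s a \<longleftrightarrow> rank c = rank a"
    using var_class_eq_iff_rank_eq[of c a] assms(2) by simp
  then have "Poly_Mapping.lookup (Poly_Mapping.single (var_class n r s c) (1::nat)) (var_class n r s a) =
      (if rank c = rank a then 1 else 0)"
    by (simp add: lookup_single when_def)
  then show ?case using add by (simp add: lookup_add)
qed simp

lemma monom_less_pair:
  assumes ind: "a \<in> indices n r" "b \<in> indices n r" "c \<in> indices n r" "e \<in> indices n r"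
    and less: "rank b < rank a" "rank c < rank a" "rank e < rank a"
  shows "monom_less n r s (monom_of n r s {#c, e#}) (monom_of n r s {#a, b#})"
  unfolding monom_less_def
proof (intro exI[of _ "var_class n r s a"] conjI allI impI)
  show "Poly_Mapping.lookup (monom_of n r s {#c, e#}) (var_class n r s a)
      < Poly_Mapping.lookup (monom_of n r s {#a, b#}) (var_class n r s a)"
    using less ind by (subst (1 2) lookup_monom_of) auto
  fix w assume w: "var_less n r s (var_class n r s a) w"
  then obtain w' where w': "w' \<in> indices n r" "w = var_class n r s w'"
    unfolding var_less_def by blast
  have "rank a < rank w'" using w w' var_less_iff_rank_less ind by blast
  then show "Poly_Mapping.lookup (monom_of n r s {#c, e#}) w = Poly_Mapping.lookup (monom_of n r s {#a, b#}) w"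
    unfolding w'(2) using less ind w'(1) by (subst (1 2) lookup_monom_of) auto
qed

text \<open>The inequality ensures that the monomial of \<open>M\<close> occurs in the binomial, with coefficient 1.\<close>

lemma rewrite_step_red_step:
  assumes M: "set_mset M \<subseteq> S" and step: "rewrite_step M M'" and ne: "monom_of n r s M \<noteq> m"
  shows "red_step n r s (G_set n r s t S :: 'k::field poly set)
    (Poly_Mapping.single (monom_of n r s M) 1 - Poly_Mapping.single m 1)
    (Poly_Mapping.single (monom_of n r s M') 1 - Poly_Mapping.single m 1)"
proof -
  obtain U K a b \<alpha> \<beta> where *: "M = U + {#a, b#}" "M' = U + {#sw K \<alpha> \<beta>, sw K \<beta> \<alpha>#}"
    "K \<subseteq> {1..t}" "(a, \<alpha>) \<in> s_equiv n r s" "(b, \<beta>) \<in> s_equiv n r s"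
    "rank b < rank a" "rank (sw K \<alpha> \<beta>) < rank a" "rank (sw K \<beta> \<alpha>) < rank a"
    using step unfolding rewrite_step_def by blast
  have S: "\<alpha> \<in> S" "\<beta> \<in> S" using * M by (auto intro: s_equiv_closed)
  have ind: "a \<in> indices n r" "b \<in> indices n r" "\<alpha> \<in> indices n r" "\<beta> \<in> indices n r"
    "sw K \<alpha> \<beta> \<in> indices n r" "sw K \<beta> \<alpha> \<in> indices n r"
    using * M S sw_closed[OF *(3)] by (auto intro: S_indices)
  have cls: "var_class n r s a = var_class n r s \<alpha>" "var_class n r s b = var_class n r s \<beta>"
    using *(4,5) ind by (simp_all add: var_class_eq_iff)
  define l where "l = monom_of n r s {#\<alpha>, \<beta>#}"
  define l' where "l' = monom_of n r s {#sw K \<alpha> \<beta>, sw K \<beta> \<alpha>#}"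
  define u where "u = monom_of n r s U"
  define g :: "'k poly" where "g = f_poly n r s K \<alpha> \<beta>"
  have g: "g = Poly_Mapping.single l 1 - Poly_Mapping.single l' 1"
    unfolding g_def f_poly_eq l_def l'_def ..
  have less: "monom_less n r s l' l"
    using monom_less_pair[OF ind(1,2,5,6) *(6,7,8)] unfolding l_def l'_def by (simp add: cls)
  have "l \<noteq> l'"
    using less unfolding monom_less_def by auto
  have lead: "is_leading_monom n r s g l"
    unfolding is_leading_monom_def g using \<open>l \<noteq> l'\<close> less
    by (auto simp: in_keys_iff lookup_minus lookup_single when_def split: if_splits)
  have "g \<in> G_set n r s t S" unfolding g_def G_set_def using *(3) S by blast
  have m: "monom_of n r s M = u + l" "monom_of n r s M' = u + l'"
    unfolding *(1,2) u_def l_def l'_def by (simp_all add: cls add.commute add.left_commute)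
  let ?p = "Poly_Mapping.single (monom_of n r s M) 1 - Poly_Mapping.single m 1 :: 'k poly"
  have "Poly_Mapping.lookup ?p (u + l) = 1"
    using ne by (simp add: lookup_minus lookup_single when_def m)
  moreover have "Poly_Mapping.lookup g l = 1"
    using \<open>l \<noteq> l'\<close> by (simp add: g lookup_minus lookup_single when_def)
  moreover have "Poly_Mapping.single (monom_of n r s M') 1 - Poly_Mapping.single m 1 =
      ?p - Poly_Mapping.single u 1 * g"
    by (simp add: g m right_diff_distrib mult_single)
  ultimately show ?thesis
    unfolding red_step_def using \<open>g \<in> G_set n r s t S\<close> lead
    by (intro bexI[of _ g] exI[of _ l] exI[of _ u]) (simp_all add: in_keys_iff)
qed

subsection \<open>Irreducible multisets\<close>

lemma ex_rewrite_stepI: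
  assumes "a \<in># M" "b \<in># M" "K \<subseteq> {1..t}" "(a, \<alpha>) \<in> s_equiv n r s" "(b, \<beta>) \<in> s_equiv n r s"
    "rank b < rank a" "rank (sw K \<alpha> \<beta>) < rank a" "rank (sw K \<beta> \<alpha>) < rank a"
  shows "\<exists>M'. rewrite_step M M'"
proof -
  obtain M1 where M1: "M = add_mset a M1" using assms(1) by (metis mset_add)
  then have "b \<in># M1" using assms(2,6) by auto
  then obtain U where "M = U + {#a, b#}" using M1 by (metis mset_add add_mset_add_single union_assoc add_mset_commute union_mset_add_mset_right empty_neutral(2))
  then show ?thesis unfolding rewrite_step_def using assms(3-) by blast
qed

lemma norm_upto_le:
  assumes "a \<in> indices n r"
  shows "norm_upto s a \<le> sum r {1..s}"
  unfolding norm_upto_def using indices_bounds(2)[OF assms] s_range by (intro sum_mono) auto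

text \<open>A class has a representative whose first \<open>s\<close> components can be increased by \<open>e\<close> without leaving the
  box, provided that the norm leaves room for it. Since \<open>r i \<ge> 2\<close> and \<open>e i \<le> 1\<close>, the upper bounds
  \<open>r i - e i\<close> still define a nonempty box.\<close>

lemma ex_shiftable_head:
  fixes e :: "nat \<Rightarrow> nat"
  assumes b: "b \<in> indices n r" and e: "\<And>i. e i \<le> 1"
    and room: "norm_upto s b + sum e {1..s} \<le> sum r {1..s}"
  obtains g where "\<And>i. i \<in> {1..s} \<Longrightarrow> 1 \<le> g i \<and> g i + e i \<le> r i" "norm_upto s g = norm_upto s b"
proof -
  have re: "1 + e i \<le> r i" if "i \<in> {1..s}" for i
    using r_ge2[of i] e[of i] that s_range by simp
  have "(\<Sum>i=1..s. r i - e i) + sum e {1..s} = sum r {1..s}"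
    unfolding sum.distrib[symmetric] using re by (intro sum.cong) fastforce+
  then have hi: "norm_upto s b \<le> (\<Sum>i=1..s. r i - e i)" using room by linarith
  obtain g where g: "\<And>i. i \<in> {1..s} \<Longrightarrow> 1 \<le> g i \<and> g i \<le> r i - e i" "sum g {1..s} = norm_upto s b"
  proof (rule ex_box_sum[of "{1..s}" "\<lambda>_. 1" "\<lambda>i. r i - e i" "norm_upto s b"])
    show "1 \<le> r i - e i" if "i \<in> {1..s}" for i using re[OF that] by simp
    show "(\<Sum>i=1..s. 1) \<le> norm_upto s b"
      unfolding norm_upto_def using indices_bounds[OF b] s_range by (intro sum_mono) auto
  qed (use hi in auto)
  show ?thesis
  proof (rule that)
    show "1 \<le> g i \<and> g i + e i \<le> r i" if "i \<in> {1..s}" for i using g(1)[OF that] re[OF that] by linarith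
  qed (use g(2) in \<open>simp only: norm_upto_def\<close>)
qed

text \<open>If the norms differ by at least 2, there are representatives \<open>f\<close> and \<open>g\<close> of the first \<open>s\<close> positions of
  \<open>a\<close> and \<open>b\<close> with \<open>f \<ge> g\<close> everywhere, and strictly at positions 1 and 2. Switching position 1 lowers
  the norm of \<open>a\<close> because of position 1, and the norm of \<open>b\<close> remains below the old norm of \<open>a\<close> because
  of position 2.\<close>

lemma irreducible_norm_balanced:
  assumes M: "set_mset M \<subseteq> S" and irr: "\<nexists>M'. rewrite_step M M'" and ab: "a \<in># M" "b \<in># M"
  shows "norm_upto s a \<le> Suc (norm_upto s b)"
proof (rule ccontr)
  assume "\<not> ?thesis"
  then have gap: "norm_upto s b + 2 \<le> norm_upto s a" by simp
  have ind: "a \<in> indices n r" "b \<in> indices n r" using M ab by (auto intro: S_indices)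
  define e where "e i = (of_bool (i \<in> {1, 2}) :: nat)" for i :: nat
  have "{1..s} = {1, 2} \<union> ({1..s} - {1, 2})" using s_range by auto
  then have "sum e {1..s} = sum e ({1, 2} \<union> ({1..s} - {1, 2}))" by simp
  also have "\<dots> = sum e {1, 2} + sum e ({1..s} - {1, 2})" by (intro sum.union_disjoint) auto
  also have "sum e ({1..s} - {1, 2}) = 0" by (intro sum.neutral) (auto simp: e_def)
  finally have sum_e: "sum e {1..s} = 2" by (simp add: e_def)
  have e_le: "e i \<le> 1" for i by (simp add: e_def)
  have room: "norm_upto s b + sum e {1..s} \<le> sum r {1..s}"
    using gap norm_upto_le[OF ind(1)] sum_e by simp
  obtain g where g: "\<And>i. i \<in> {1..s} \<Longrightarrow> 1 \<le> g i \<and> g i + e i \<le> r i"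
    "norm_upto s g = norm_upto s b"
    using ex_shiftable_head[OF ind(2) e_le room] by blast
  have sum_ge: "(\<Sum>i=1..s. g i + e i) = norm_upto s b + 2" using g(2) sum_e by (simp add: sum.distrib norm_upto_def)
  obtain f where f: "\<And>i. i \<in> {1..s} \<Longrightarrow> g i + e i \<le> f i \<and> f i \<le> r i" "sum f {1..s} = norm_upto s a"
  proof (rule ex_box_sum[of "{1..s}" "\<lambda>i. g i + e i" r "norm_upto s a"])
    show "g i + e i \<le> r i" if "i \<in> {1..s}" for i
      using g(1)[OF that] by simp
    show "(\<Sum>i=1..s. g i + e i) \<le> norm_upto s a" using sum_ge gap by simp
  qed (use norm_upto_le[OF ind(1)] in auto)
  have f': "1 \<le> f i \<and> f i \<le> r i" if "i \<in> {1..s}" for i using f(1)[OF that] g(1)[OF that] by auto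
  have g': "1 \<le> g i \<and> g i \<le> r i" if "i \<in> {1..s}" for i using g(1)[OF that] by auto
  define \<alpha> \<beta> where "\<alpha> = sw {1..s} a f" and "\<beta> = sw {1..s} b g"
  have equiv: "(a, \<alpha>) \<in> s_equiv n r s" "(b, \<beta>) \<in> s_equiv n r s"
    unfolding \<alpha>_def \<beta>_def 
    by (rule s_equiv_head[where h = f, OF ind(1) f']; simp add: f(2)[folded norm_upto_def])
      (rule s_equiv_head[where h = g, OF ind(2) g']; simp add: g(2))
  then have ind': "\<alpha> \<in> indices n r" "\<beta> \<in> indices n r" by (auto simp: s_equiv_def)
  have one: "1 \<in> {1..s}" "2 \<in> {1..s}" "{1} \<subseteq> {1..t}" using s_range t_range by auto
  have split: "sum q {1..s} = q 1 + sum q {2..s}" for q :: "nat \<Rightarrow> nat"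
    using s_range by (simp add: sum.atLeast_Suc_atMost numeral_2_eq_2)
  have norm1: "norm_upto s (sw {1} \<alpha> \<beta>) = g 1 + sum f {2..s}"
    unfolding norm_upto_def split using one by (auto simp: sw_apply \<alpha>_def \<beta>_def intro!: sum.cong)
  have norm2: "norm_upto s (sw {1} \<beta> \<alpha>) = f 1 + sum g {2..s}"
    unfolding norm_upto_def split using one by (auto simp: sw_apply \<alpha>_def \<beta>_def intro!: sum.cong)
  have first: "g 1 < f 1" using f(1)[OF one(1)] by (simp add: e_def)
  have "sum g {2..s} < sum f {2..s}"
  proof (rule sum_strict_mono_ex1)
    show "\<forall>x\<in>{2..s}. g x \<le> f x"
    proof
      fix x assume "x \<in> {2..s}"
      then show "g x \<le> f x" using f(1)[of x] by simp
    qed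
    show "\<exists>x\<in>{2..s}. g x < f x"
      using f(1)[OF one(2)] one(2) by (intro bexI[of _ 2]) (auto simp: e_def)
  qed simp
  then have "norm_upto s (sw {1} \<alpha> \<beta>) < norm_upto s a" "norm_upto s (sw {1} \<beta> \<alpha>) < norm_upto s a"
    using first f(2) split[of f] norm1 norm2 by linarith+
  then have "rank (sw {1} \<alpha> \<beta>) < rank a" "rank (sw {1} \<beta> \<alpha>) < rank a" "rank b < rank a"
    using gap ind ind' s_range by (auto simp: code_less_iff sw_in_indices)
  then show False using ex_rewrite_stepI[OF ab one(3) equiv] irr by blast
qed

text \<open>If the component of \<open>a\<close> were larger, switching this position alone would lower \<open>a\<close>, and \<open>b\<close> would
  remain below \<open>a\<close> because of the earlier blocks.\<close>

lemma irreducible_digit_antitone: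
  assumes M: "set_mset M \<subseteq> S" and irr: "\<nexists>M'. rewrite_step M M'" and ab: "a \<in># M" "b \<in># M"
    and m: "m < t - s" and less: "code m b < code m a"
  shows "a (s + Suc m) \<le> b (s + Suc m)"
proof (rule ccontr)
  assume "\<not> ?thesis"
  then have dig: "b (s + Suc m) < a (s + Suc m)" by simp
  have ind: "a \<in> indices n r" "b \<in> indices n r" using M ab by (auto intro: S_indices)
  have mn: "Suc m \<le> n - s" "s + (n - s) \<le> n" "m \<le> n - s" "s + Suc m \<le> n" using m t_range s_range by auto
  define K where "K = {s + Suc m}"
  have K: "K \<subseteq> {1..t}" using m by (auto simp: K_def)
  have ind': "sw K a b \<in> indices n r" "sw K b a \<in> indices n r" using ind by (auto intro: sw_in_indices)
  have same: "code m (sw K a b) = code m a" "code m (sw K b a) = code m b"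
    by (auto intro!: code_cong norm_upto_cong simp: sw_apply K_def)
  have "code (Suc m) (sw K a b) < code (Suc m) a"
    using dig unfolding code_Suc same by (simp add: sw_apply K_def)
  then have "rank (sw K a b) < rank a" by (rule code_less_mono[OF ind'(1) ind(1) mn(1,2)])
  moreover have "rank (sw K b a) < rank a"
    using less unfolding same(2)[symmetric] by (rule code_less_mono[OF ind'(2) ind(1) mn(3,2)])
  moreover have "rank b < rank a"
    using less by (rule code_less_mono[OF ind(2,1) mn(3,2)])
  moreover have "(a, a) \<in> s_equiv n r s" "(b, b) \<in> s_equiv n r s" using ind by (auto simp: s_equiv_def)
  ultimately show False using ex_rewrite_stepI[OF ab K] irr by blast
qed

text \<open>If the final block of \<open>a\<close> were larger, then \<open>a\<close> and \<open>b\<close> with exchanged final blocks would both be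
  below \<open>a\<close>. This exchange is obtained by switching all of the other blocks instead. The norms are
  exchanged by switching position 1 of representatives that differ there by \<open>\<delta> \<le> 1\<close> and agree on the
  other positions up to \<open>s\<close>.\<close>

lemma irreducible_tail_antitone:
  assumes M: "set_mset M \<subseteq> S" and irr: "\<nexists>M'. rewrite_step M M'" and ab: "a \<in># M" "b \<in># M"
    and less: "code (t - s) b < code (t - s) a"
  shows "tail a \<le> tail b"
proof (rule ccontr)
  assume "\<not> ?thesis"
  then have tl: "tail b < tail a" by simp
  have ind: "a \<in> indices n r" "b \<in> indices n r" using M ab by (auto intro: S_indices)
  define \<delta> where "\<delta> = norm_upto s a - norm_upto s b"
  have "norm_upto s b \<le> norm_upto s a"
    using less block_end_le unfolding code_less_iff[OF ind(2,1) block_end_le(3)] by auto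
  moreover have "norm_upto s a \<le> Suc (norm_upto s b)"
    by (rule irreducible_norm_balanced[OF M irr ab])
  ultimately have \<delta>: "norm_upto s a = norm_upto s b + \<delta>" "\<delta> \<le> 1" by (auto simp: \<delta>_def)
  define e where "e i = (if i = 1 then \<delta> else 0)" for i :: nat
  have sum_e: "sum e {1..s} = \<delta>" using s_range by (simp add: e_def sum.delta)
  have e_le: "e i \<le> 1" for i using \<delta>(2) by (simp add: e_def)
  have room: "norm_upto s b + sum e {1..s} \<le> sum r {1..s}"
    using \<delta>(1) norm_upto_le[OF ind(1)] sum_e by simp
  obtain g where g: "\<And>i. i \<in> {1..s} \<Longrightarrow> 1 \<le> g i \<and> g i + e i \<le> r i"
    "norm_upto s g = norm_upto s b"
    using ex_shiftable_head[OF ind(2) e_le room] by blast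
  define f where "f i = g i + e i" for i
  have f: "1 \<le> f i \<and> f i \<le> r i" "1 \<le> g i \<and> g i \<le> r i" if "i \<in> {1..s}" for i
    using g(1)[OF that] by (auto simp: f_def)
  have sum_f: "sum f {1..s} = norm_upto s a"
    using g(2) sum_e \<delta>(1) by (simp add: f_def sum.distrib norm_upto_def)
  define \<alpha> \<beta> where "\<alpha> = sw {1..s} a f" and "\<beta> = sw {1..s} b g"
  have equiv: "(a, \<alpha>) \<in> s_equiv n r s" "(b, \<beta>) \<in> s_equiv n r s"
    unfolding \<alpha>_def \<beta>_def 
    by (rule s_equiv_head[where h = f, OF ind(1) f(1)]; simp add: sum_f[folded norm_upto_def])
      (rule s_equiv_head[where h = g, OF ind(2) f(2)]; simp add: g(2))
  then have ind': "\<alpha> \<in> indices n r" "\<beta> \<in> indices n r" by (auto simp: s_equiv_def)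
  \<comment> \<open>For \<open>s \<ge> t\<close> this is just \<open>{1}\<close>.\<close>
  define K where "K = insert 1 {s+1..t}"
  have K: "K \<subseteq> {1..t}" using t_range by (auto simp: K_def)
  have head: "sw K \<alpha> \<beta> i = g i" "sw K \<beta> \<alpha> i = f i" if "i \<in> {1..s}" for i
    using that by (auto simp: sw_apply K_def \<alpha>_def \<beta>_def f_def e_def)
  have norm: "norm_upto s (sw K \<alpha> \<beta>) = norm_upto s b" "norm_upto s (sw K \<beta> \<alpha>) = norm_upto s a"
    unfolding norm_upto_def using g(2) sum_f head by (simp_all add: norm_upto_def)
  have codes: "code (t - s) (sw K \<alpha> \<beta>) = code (t - s) b" "code (t - s) (sw K \<beta> \<alpha>) = code (t - s) a"
    by (rule code_cong; use norm s_range in \<open>auto simp: sw_apply K_def \<alpha>_def \<beta>_def\<close>)+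
  have tail_eq: "tail (sw K \<beta> \<alpha>) = tail b"
    using K s_range by (intro tail_cong) (auto simp: sw_apply \<beta>_def)
  have ind'': "sw K \<alpha> \<beta> \<in> indices n r" "sw K \<beta> \<alpha> \<in> indices n r" using ind' by (auto intro: sw_in_indices)
  have mn: "t - s \<le> n - s" "s + (n - s) \<le> n" using t_range s_range by auto
  have "rank (sw K \<alpha> \<beta>) < rank a"
    using less unfolding codes(1)[symmetric] by (rule code_less_mono[OF ind''(1) ind(1) mn])
  moreover have "rank (sw K \<beta> \<alpha>) < rank a"
    unfolding rank_tail codes(2) tail_eq using tl by simp
  moreover have "rank b < rank a" using less by (rule code_less_mono[OF ind(2,1) mn])
  ultimately show False using ex_rewrite_stepI[OF ab K equiv] irr by blast
qed

lemma coupling_image_eqI: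
  fixes f g :: "index \<Rightarrow> nat"
  assumes "image_mset f M = image_mset f M'" "image_mset g M = image_mset g M'"
    and "\<And>a b. a \<in># M \<Longrightarrow> b \<in># M \<Longrightarrow> f b < f a \<Longrightarrow> g a \<le> g b"
    and "\<And>a b. a \<in># M' \<Longrightarrow> b \<in># M' \<Longrightarrow> f b < f a \<Longrightarrow> g a \<le> g b"
  shows "image_mset (\<lambda>a. \<phi> (f a) (g a)) M = image_mset (\<lambda>a. \<phi> (f a) (g a)) M'"
proof -
  have "image_mset (\<lambda>a. (f a, g a)) M = image_mset (\<lambda>a. (f a, g a)) M'"
    by (rule antitone_coupling_eqI) (use assms in \<open>auto simp: multiset.map_comp comp_def\<close>)
  from arg_cong[OF this, of "image_mset (\<lambda>(x, y). \<phi> x y)"]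
  show ?thesis by (simp add: multiset.map_comp comp_def)
qed

text \<open>By induction over the blocks, the multiset of the codes of the initial sequences is determined by the
  invariants. The last step adds the final block and yields the multiset of ranks, hence that of
  variables.\<close>

lemma irreducible_unique:
  assumes M: "set_mset M \<subseteq> S" "\<nexists>N. rewrite_step M N"
    and M': "set_mset M' \<subseteq> S" "\<nexists>N. rewrite_step M' N"
    and inv: "same_invariants M M'"
  shows "monom_of n r s M = monom_of n r s M'"
proof -
  have "size M = size M'" using inv unfolding same_invariants_def by (metis size_image_mset)
  then have norm: "image_mset (norm_upto s) M = image_mset (norm_upto s) M'"
    using inv irreducible_norm_balanced[OF M] irreducible_norm_balanced[OF M']
    by (intro balanced_mset_eqI) (auto simp: same_invariants_def)
  have "m \<le> t - s \<Longrightarrow> image_mset (code m) M = image_mset (code m) M'" for m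
  proof (induction m)
    case 0
    then show ?case using norm by (simp add: code_0)
  next
    case (Suc m)
    have "image_mset (\<lambda>a. code m a * base + a (s + Suc m)) M =
        image_mset (\<lambda>a. code m a * base + a (s + Suc m)) M'"
    proof (rule coupling_image_eqI[where f = "code m" and g = "\<lambda>a. a (s + Suc m)" and \<phi> = "\<lambda>x y. x * base + y"])
      show "image_mset (\<lambda>a. a (s + Suc m)) M = image_mset (\<lambda>a. a (s + Suc m)) M'"
        using inv Suc.prems unfolding same_invariants_def by auto
    qed (use Suc irreducible_digit_antitone[OF M] irreducible_digit_antitone[OF M'] in auto)
    then show ?case by (simp add: code_Suc)
  qed
  then have codes: "image_mset (code (t - s)) M = image_mset (code (t - s)) M'" by simp
  have tails: "image_mset tail M = image_mset tail M'"
  proof -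
    have "tail c = tail (restrict c {block_end+1..n})" for c by (rule tail_cong) simp
    then have "image_mset tail A = image_mset tail (image_mset (\<lambda>c. restrict c {block_end+1..n}) A)" for A
      by (simp add: multiset.map_comp comp_def)
    then show ?thesis using inv unfolding same_invariants_def by metis
  qed
  have ranks: "image_mset rank M = image_mset rank M'"
    unfolding rank_tail
    by (rule coupling_image_eqI[OF codes tails, where \<phi> = "\<lambda>x y. x * base ^ (n - block_end) + y"])
      (use irreducible_tail_antitone[OF M] irreducible_tail_antitone[OF M'] in auto)
  define cls where "cls k = var_class n r s (inv_into (indices n r) rank k)" for k
  have cls: "cls (rank a) = var_class n r s a" if "a \<in> indices n r" for a
  proof -
    have "inv_into (indices n r) rank (rank a) \<in> indices n r"
      "rank (inv_into (indices n r) rank (rank a)) = rank a"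
      using imageI[OF that, of rank] by (rule inv_into_into, rule f_inv_into_f)
    then show ?thesis unfolding cls_def using var_class_eq_iff_rank_eq that by blast
  qed
  have "image_mset (var_class n r s) A = image_mset cls (image_mset rank A)" if "set_mset A \<subseteq> S" for A
    unfolding multiset.map_comp
    by (rule image_mset_cong) (use that S_indices cls in auto)
  then have "image_mset (var_class n r s) M = image_mset (var_class n r s) M'"
    using ranks M(1) M'(1) by metis
  from arg_cong[OF this, of "\<lambda>A. \<Sum>v\<in>#A. Poly_Mapping.single v (1::nat)"]
  show ?thesis by (simp add: monom_of_def multiset.map_comp comp_def)
qed

lemma same_invariants_sym: "same_invariants M M' \<Longrightarrow> same_invariants M' M"
  and same_invariants_trans: "same_invariants M M' \<Longrightarrow> same_invariants M' M'' \<Longrightarrow> same_invariants M M''"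
  unfolding same_invariants_def by auto

text \<open>As long as the two monomials differ, they are not both irreducible, so one of them can be rewritten.\<close>

lemma same_invariants_imp_reduces_to_zero:
  assumes "set_mset M \<subseteq> S" "set_mset M' \<subseteq> S" "same_invariants M M'"
  shows "reduces_to_zero n r s (G_set n r s t S)
    (Poly_Mapping.single (monom_of n r s M) 1 - Poly_Mapping.single (monom_of n r s M') 1 :: 'k::field poly)"
  using assms
proof (induction "weight M + weight M'" arbitrary: M M' rule: less_induct)
  case less
  have reduce: ?case
    if st: "rewrite_step A A'" and ne: "monom_of n r s A \<noteq> monom_of n r s C"
      and AC: "A = M \<and> C = M' \<or> A = M' \<and> C = M" for A A' C
  proof -
    let ?p = "\<lambda>A. Poly_Mapping.single (monom_of n r s A) 1 - Poly_Mapping.single (monom_of n r s C) 1 :: 'k poly"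
    have A: "set_mset A \<subseteq> S" "set_mset C \<subseteq> S" "same_invariants A C"
      using AC less.prems same_invariants_sym by auto
    have "set_mset A' \<subseteq> S" "same_invariants A' C"
      using rewrite_step_invariants[OF A(1) st] A(3) same_invariants_sym same_invariants_trans by blast+
    moreover have "weight A' + weight C < weight M + weight M'"
      using rewrite_step_weight[OF st] AC by auto
    ultimately have "reduces_to_zero n r s (G_set n r s t S) (?p A')"
      using less.hyps A(2) by blast
    then have red: "reduces_to_zero n r s (G_set n r s t S) (?p A)"
      using rewrite_step_red_step[OF A(1) st ne, where 'k = 'k] unfolding reduces_to_zero_def
      by (rule converse_rtranclp_into_rtranclp[rotated])
    from AC show ?case
    proof
      assume "A = M' \<and> C = M"
      then show ?thesis using reduces_to_zero_uminus[OF red] by simp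
    qed (use red in simp)
  qed
  show ?case
  proof (cases "monom_of n r s M = monom_of n r s M'")
    case True
    then show ?thesis by (simp add: reduces_to_zero_def)
  next
    case False
    then consider A where "rewrite_step M A" | A where "rewrite_step M' A"
      using irreducible_unique less.prems by blast
    then show ?thesis using reduce False by cases metis+
  qed
qed

lemma reduces_to_zero_imp_same_invariants:
  assumes M: "set_mset M \<subseteq> S" "set_mset M' \<subseteq> S"
    and red: "reduces_to_zero n r s (G_set n r s t S)
      (Poly_Mapping.single (monom_of n r s M) 1 - Poly_Mapping.single (monom_of n r s M') 1 :: 'k::field poly)"
  shows "same_invariants M M'"
proof -
  have ind: "S \<subseteq> indices n r" "set_mset M \<subseteq> indices n r" "set_mset M' \<subseteq> indices n r"
    using M S_indices by auto
  note eq = reduces_to_zero_imp_invariant_eq[OF ind(1) _ _ ind(2,3) red]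
  have "(\<Sum>c\<in>#M. norm_upto s c) = (\<Sum>c\<in>#M'. norm_upto s c)"
  proof (rule eq)
    show "norm_upto s a = norm_upto s b" if "(a, b) \<in> s_equiv n r s" for a b
      using that by (simp add: s_equiv_def norm_upto_def)
  qed (rule norm_upto_sw)
  moreover have "image_mset (\<lambda>c. c i) M = image_mset (\<lambda>c. c i) M'" if "i \<in> {s+1..block_end}" for i
  proof (rule multiset_eqI)
    have "i \<in> {s+1..n}" using that block_end_le(3) by auto
    then have "(\<Sum>c\<in>#M. of_bool (c i = v)) = (\<Sum>c\<in>#M'. of_bool (c i = v) :: nat)" for v
      by (intro eq) (auto simp: s_equiv_def sw_apply)
    then show "count (image_mset (\<lambda>c. c i) M) v = count (image_mset (\<lambda>c. c i) M') v" for v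
      by (simp add: sum_mset_of_bool_eq_count)
  qed
  moreover have "image_mset (\<lambda>c. restrict c {block_end+1..n}) M = image_mset (\<lambda>c. restrict c {block_end+1..n}) M'"
  proof (rule multiset_eqI)
    have "restrict a {block_end+1..n} = restrict b {block_end+1..n}" if "(a, b) \<in> s_equiv n r s" for a b
      using that by (intro restrict_ext) (auto simp: s_equiv_def)
    then have "(\<Sum>c\<in>#M. of_bool (restrict c {block_end+1..n} = v)) =
        (\<Sum>c\<in>#M'. of_bool (restrict c {block_end+1..n} = v) :: nat)" for v
      by (intro eq) (simp_all only: restrict_sw_tail)
    then show "count (image_mset (\<lambda>c. restrict c {block_end+1..n}) M) v =
        count (image_mset (\<lambda>c. restrict c {block_end+1..n}) M') v" for v
      by (simp add: sum_mset_of_bool_eq_count)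
  qed
  ultimately show ?thesis unfolding same_invariants_def by blast
qed

end

theorem theorem3p5:
  fixes n s t d :: nat
    and r :: "nat \<Rightarrow> nat"
    and S :: "index set"
    and a b :: "nat \<Rightarrow> index"
    and p :: "'k::field poly"
  assumes "n \<ge> 1"
    and "\<And>i. i \<in> {1..n} \<Longrightarrow> r i \<ge> 2"
    and "s \<in> {1..n}" and "t \<in> {1..n}" and "s \<ge> 2"
    and "connected_indices n S" and "switchable n r s t S"
    and "d \<ge> 1"
    and "\<And>j. j \<in> {1..d} \<Longrightarrow> a j \<in> S"
    and "\<And>j. j \<in> {1..d} \<Longrightarrow> b j \<in> S"
    and "p = (\<Prod>j=1..d. X n r s (a j)) - (\<Prod>j=1..d. X n r s (b j))"
  shows "reduces_to_zero n r s (G_set n r s t S) p \<longleftrightarrow>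
    (\<Sum>j=1..d. norm_upto s (a j)) = (\<Sum>j=1..d. norm_upto s (b j)) \<and>
    (s \<le> t \<longrightarrow>
      (\<forall>i\<in>{s+1..t}. {# a j i. j \<in># mset_set {1..d} #} = {# b j i. j \<in># mset_set {1..d} #}) \<and>
      {# restrict (a j) {t+1..n}. j \<in># mset_set {1..d} #} =
      {# restrict (b j) {t+1..n}. j \<in># mset_set {1..d} #}) \<and>
    (s \<ge> t \<longrightarrow>
      {# restrict (a j) {s+1..n}. j \<in># mset_set {1..d} #} =
      {# restrict (b j) {s+1..n}. j \<in># mset_set {1..d} #})"
proof -
  interpret connected_switchable n s t r S
    using assms by unfold_locales
  define M M' where "M = image_mset a (mset_set {1..d})" and "M' = image_mset b (mset_set {1..d})"
  have sub: "set_mset M \<subseteq> S" "set_mset M' \<subseteq> S"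
    using assms(9,10) by (auto simp: M_def M'_def)
  have p: "p = Poly_Mapping.single (monom_of n r s M) 1 - Poly_Mapping.single (monom_of n r s M') 1"
    unfolding assms(11) prod_X M_def M'_def ..
  have "reduces_to_zero n r s (G_set n r s t S) p \<longleftrightarrow> same_invariants M M'"
    unfolding p using sub same_invariants_imp_reduces_to_zero reduces_to_zero_imp_same_invariants by blast
  also have "\<dots> \<longleftrightarrow>
    (\<Sum>j=1..d. norm_upto s (a j)) = (\<Sum>j=1..d. norm_upto s (b j)) \<and>
    (\<forall>i\<in>{s+1..block_end}. {# a j i. j \<in># mset_set {1..d} #} = {# b j i. j \<in># mset_set {1..d} #}) \<and>
      {# restrict (a j) {block_end+1..n}. j \<in># mset_set {1..d} #} =
      {# restrict (b j) {block_end+1..n}. j \<in># mset_set {1..d} #}"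
    unfolding same_invariants_def M_def M'_def by (simp add: multiset.map_comp comp_def sum_unfold_sum_mset)
  finally show ?thesis by (cases "s \<le> t") auto
qed

end
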